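(* Let $n\ge 7$ and $3\le k\le n-3$, and let $H$ be a strong $k$-tournament on $n$ vertices. Then: (i) $H$ is vertex-pancyclic; (ii) every Hamiltonian cycle $C$ of $H$ contains at least three pancyclic hyperarcs.
   Context: For $2\le k\le n$, a $k$-tournament $H$ on $n$ vertices is a pair $(V,A)$ where $V$ is a set of $n$ vertices and $A$ is a set of $k$-tuples of distinct vertices (hyperarcs) such that for every $k$-subset $S\subseteq V$, $A$ contains exactly one of the $k!$ orderings of $S$. For a hyperarc $a=(x_1\dots x_k)$, $x_i$ precedes $x_j$ in $a$ if $i<j$. A path of length $m$ is an alternating sequence $x_1a_1x_2\dots x_ma_mx_{m+1}$ of distinct vertices and distinct hyperarcs with $x_i$ preceding $x_{i+1}$ in $a_i$; it is a cycle of length $m$ if instead $x_{m+1}=x_1$ (other vertices distinct). A cycle is Hamiltonian if it contains all vertices. $H$ is strong if for every ordered pair $(u,v)$ of distinct vertices there is a path from $u$ to $v$. A vertex (resp. hyperarc) is pancyclic if it is contained in a cycle of length $l$ for every $l\in\{3,\dots,n\}$; $H$ is vertex-pancyclic if all its vertices are pancyclic. *)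

theory Defs
  imports Main
begin

definition k_tournament :: "nat \<Rightarrow> 'a set \<Rightarrow> 'a list set \<Rightarrow> bool" where
  "k_tournament k V A \<longleftrightarrow> finite V \<and> 2 \<le> k \<and> k \<le> card V \<and>
     (\<forall>a\<in>A. distinct a \<and> length a = k \<and> set a \<subseteq> V) \<and>
     (\<forall>S. S \<subseteq> V \<and> card S = k \<longrightarrow> (\<exists>!a. a \<in> A \<and> set a = S))"

definition precedes :: "'a list \<Rightarrow> 'a \<Rightarrow> 'a \<Rightarrow> bool" where
  "precedes a x y \<longleftrightarrow> (\<exists>i j. i < j \<and> j < length a \<and> a ! i = x \<and> a ! j = y)"

definition is_path :: "'a set \<Rightarrow> 'a list set \<Rightarrow> 'a list \<Rightarrow> 'a list list \<Rightarrow> bool" where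
  "is_path V A xs as \<longleftrightarrow> length xs = length as + 1 \<and> distinct xs \<and> distinct as \<and>
     set xs \<subseteq> V \<and> set as \<subseteq> A \<and>
     (\<forall>i < length as. precedes (as ! i) (xs ! i) (xs ! Suc i))"

definition is_cycle :: "'a set \<Rightarrow> 'a list set \<Rightarrow> 'a list \<Rightarrow> 'a list list \<Rightarrow> bool" where
  "is_cycle V A xs as \<longleftrightarrow> xs \<noteq> [] \<and> length xs = length as \<and> distinct xs \<and> distinct as \<and>
     set xs \<subseteq> V \<and> set as \<subseteq> A \<and>
     (\<forall>i < length as. precedes (as ! i) (xs ! i) (xs ! ((i + 1) mod length xs)))"

definition hamiltonian_cycle :: "'a set \<Rightarrow> 'a list set \<Rightarrow> 'a list \<Rightarrow> 'a list list \<Rightarrow> bool" where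
  "hamiltonian_cycle V A xs as \<longleftrightarrow> is_cycle V A xs as \<and> set xs = V"

definition strong :: "'a set \<Rightarrow> 'a list set \<Rightarrow> bool" where
  "strong V A \<longleftrightarrow> (\<forall>u\<in>V. \<forall>v\<in>V. u \<noteq> v \<longrightarrow>
     (\<exists>xs as. is_path V A xs as \<and> hd xs = u \<and> last xs = v))"

definition pancyclic_vertex :: "'a set \<Rightarrow> 'a list set \<Rightarrow> 'a \<Rightarrow> bool" where
  "pancyclic_vertex V A v \<longleftrightarrow> (\<forall>l \<in> {3..card V}.
     \<exists>xs as. is_cycle V A xs as \<and> length xs = l \<and> v \<in> set xs)"

definition pancyclic_arc :: "'a set \<Rightarrow> 'a list set \<Rightarrow> 'a list \<Rightarrow> bool" where
  "pancyclic_arc V A a \<longleftrightarrow> (\<forall>l \<in> {3..card V}.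
     \<exists>xs as. is_cycle V A xs as \<and> length xs = l \<and> a \<in> set as)"

definition vertex_pancyclic :: "'a set \<Rightarrow> 'a list set \<Rightarrow> bool" where
  "vertex_pancyclic V A \<longleftrightarrow> (\<forall>v\<in>V. pancyclic_vertex V A v)"

end

theory Submission
  imports Complex_Main Defs "HOL-Library.Sublist" "HOL-Library.Multiset"
begin

text \<open>
  For vertices \<open>u \<noteq> v\<close> there are \<open>(n-2 choose k-2)\<close> hyperarcs containing both; call the pair \<open>(u, v)\<close>
  heavy if \<open>u\<close> precedes \<open>v\<close> in at least half of them. Heavy pairs have so many hyperarcs that along any
  cycle distinct ones can be chosen, greedily or, for \<open>n = 7\<close> and \<open>k = 4\<close>, by Hall's theorem, even if
  some arcs of the cycle come with prescribed hyperarcs.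

  The heavy pairs form a semicomplete digraph, so some vertex \<open>r\<close> reaches every vertex and some
  vertex \<open>s\<close> is reached by every vertex. Adding the arcs of a shortest path of the hypertournament
  from \<open>s\<close> to \<open>r\<close> makes this digraph strong, hence Hamiltonian, and a Hamiltonian cycle lifts to the
  hypertournament.

  Given a Hamiltonian cycle, its arcs together with heavy pairs for the chords form a strong
  tournament, every short cycle of which lifts with the original hyperarcs on the arcs of the
  Hamiltonian cycle. So it remains to prove Moon's theorems for tournaments: all vertices of a strong
  tournament are pancyclic, and so are at least three arcs of every Hamiltonian cycle. The latter goes
  by induction, shortcutting the cycle by a forward chord of minimal span \<open>d\<close>: all chords of span
  between \<open>2\<close> and \<open>d - 1\<close> then point backwards.
\<close>

section \<open>Paths and insertion\<close>

text \<open>The induction for the arcs yields cycles of length at most \<open>n - d + 1\<close>, so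
  arcs that are pancyclic on the shortened cycle must be extended over the \<open>d - 1\<close>
  skipped vertices. This may fail, and losses are then balanced against gains: a failing arc makes
  at least two skipped vertices uninsertable, each of these is uninsertable for one arc only, and a
  single failure makes at least \<open>max 1 (d - 3)\<close> skipped arcs pancyclic. Minimality of
  \<open>d\<close> fixes enough directions for this. For the hyperarcs, a heavy pair has at least
  \<open>n\<close> of them if \<open>k >= 4\<close> and \<open>n >= 8\<close>, so a greedy choice
  never gets stuck; for \<open>k = 3\<close> it has at least three, and only the two neighbouring
  arcs of a cycle compete for them. What remains is \<open>n = 7\<close>, \<open>k = 4\<close>, with
  ten hyperarcs per pair. There Hall's condition is verified for at most four prescribed hyperarcs.
  Five or more can occur in two places, both treated separately: a shortest path with five or six
  arcs, and a cycle of five original arcs and one chord.\<close>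

definition has_path :: "('a \<Rightarrow> 'a \<Rightarrow> bool) \<Rightarrow> 'a set \<Rightarrow> 'a \<Rightarrow> 'a \<Rightarrow> nat \<Rightarrow> bool" where
  "has_path E W u v l \<longleftrightarrow> (\<exists>zs. zs \<noteq> [] \<and> hd zs = u \<and> last zs = v \<and> distinct zs \<and>
     set zs \<subseteq> W \<and> length zs = l \<and> successively E zs)"

text \<open>A path on \<open>l\<close> vertices from \<open>v\<close> back to \<open>u\<close>
  closes up to a cycle of length \<open>l\<close> through the arc from \<open>u\<close> to
  \<open>v\<close>. That this arc exists is left to the context.\<close>

definition pancyclic_pair :: "('a \<Rightarrow> 'a \<Rightarrow> bool) \<Rightarrow> 'a set \<Rightarrow> 'a \<Rightarrow> 'a \<Rightarrow> bool" where
  "pancyclic_pair E W u v \<longleftrightarrow> (\<forall>l\<in>{3..card W}. has_path E W v u l)"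

text \<open>The vertices \<open>u\<close> and \<open>v\<close> need not be adjacent in
  \<open>L\<close>. In this weak form the property survives when other vertices are inserted into
  \<open>L\<close>.\<close>

definition insertable :: "('a \<Rightarrow> 'a \<Rightarrow> bool) \<Rightarrow> 'a \<Rightarrow> 'a list \<Rightarrow> bool" where
  "insertable E w L \<longleftrightarrow> (\<exists>u v. subseq [u, v] L \<and> E u w \<and> E w v)"

lemma has_path_mono: "has_path E W u v l \<Longrightarrow> W \<subseteq> W' \<Longrightarrow> has_path E W' u v l"
  unfolding has_path_def by blast

lemma insertable_subseq: "insertable E w L \<Longrightarrow> subseq L L' \<Longrightarrow> insertable E w L'"
  unfolding insertable_def using subseq_order.trans by blast

lemma insertable_upt:
  assumes "a \<le> u" "u < v" "v < b" "E u w" "E w v"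
  shows "insertable E w [a..<b]"
proof -
  have "[a..<b] = [a..<u] @ [u..<v] @ [v..<b]"
    using assms by (metis le_add_diff_inverse less_imp_le_nat order_trans upt_add_eq_append)
  moreover have "subseq [u] [u..<v]" "subseq [v] [v..<b]"
    using assms by (simp_all add: subseq_singleton_left)
  ultimately have "subseq ([] @ [u] @ [v]) [a..<b]"
    by (metis list_emb_append_mono list_emb_Nil)
  then show ?thesis using assms unfolding insertable_def by auto
qed

text \<open>A discrete intermediate value argument: between an in-neighbour of \<open>w\<close> and
  a later out-neighbour, the direction flips at some adjacent pair.\<close>

lemma insertable_split:
  assumes "insertable E w L" and "\<And>v. v \<in> set L \<Longrightarrow> E v w \<or> E w v"
  shows "\<exists>A B. L = A @ B \<and> A \<noteq> [] \<and> B \<noteq> [] \<and> E (last A) w \<and> E w (hd B)"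
  using assms
proof (induction L)
  case Nil
  then show ?case by (simp add: insertable_def)
next
  case (Cons a L)
  from Cons.prems obtain u v where uv: "subseq [u, v] (a # L)" "E u w" "E w v"
    unfolding insertable_def by blast
  then obtain b L' where L: "L = b # L'"
    by (cases L) (auto split: if_splits)
  show ?case
  proof (cases "E a w \<and> E w b")
    case True
    then have "a # L = [a] @ L \<and> [a] \<noteq> [] \<and> L \<noteq> [] \<and> E (last [a]) w \<and> E w (hd L)"
      using L by simp
    then show ?thesis by blast
  next
    case False
    have "insertable E w L"
    proof (cases "subseq [u, v] L")
      case True
      then show ?thesis using uv unfolding insertable_def by blast
    next
      case nL: False
      then have "u = a" "subseq [v] L" using uv(1) by (auto split: if_splits)
      with False uv have "\<not> E w b" by simp
      then have "E b w" "v \<noteq> b" using Cons.prems(2)[of b] L uv by auto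
      then have "subseq [v] L'" using \<open>subseq [v] L\<close> L by (simp split: if_splits)
      then have "subseq [b, v] L" using L by simp
      then show ?thesis using \<open>E b w\<close> uv unfolding insertable_def by blast
    qed
    then obtain A B where "L = A @ B \<and> A \<noteq> [] \<and> B \<noteq> [] \<and> E (last A) w \<and> E w (hd B)"
      using Cons.IH Cons.prems(2) by (metis list.set_intros(2))
    then have "a # L = (a # A) @ B \<and> a # A \<noteq> [] \<and> B \<noteq> [] \<and> E (last (a # A)) w \<and> E w (hd B)"
      by simp
    then show ?thesis by blast
  qed
qed

text \<open>The last two conjuncts locate \<open>w\<close> relative to the ends, so that further
  vertices can be inserted between \<open>w\<close> and an end.\<close>

lemma insert_vertex:
  assumes "insertable E w L" "\<And>v. v \<in> set L \<Longrightarrow> E v w \<or> E w v" "successively E L"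
  shows "\<exists>L'. successively E L' \<and> subseq L L' \<and> hd L' = hd L \<and> last L' = last L \<and>
     mset L' = add_mset w (mset L) \<and> subseq [hd L, w] L' \<and> subseq [w, last L] L'"
proof -
  obtain A B where AB: "L = A @ B" "A \<noteq> []" "B \<noteq> []" "E (last A) w" "E w (hd B)"
    using insertable_split[OF assms(1,2)] by blast
  let ?L = "A @ w # B"
  have "successively E ?L"
    using AB assms(3) by (simp add: successively_append_iff successively_Cons)
  moreover have "subseq L ?L" unfolding AB(1) by (intro list_emb_append_mono list_emb_Cons) auto
  moreover have "subseq ([hd A] @ [w] @ []) (A @ [w] @ B)"
    using AB by (intro list_emb_append_mono) (auto simp: subseq_singleton_left)
  moreover have "subseq ([] @ [w] @ [last B]) (A @ [w] @ B)"
    using AB by (intro list_emb_append_mono) (auto simp: subseq_singleton_left)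
  ultimately show ?thesis
    using AB by (intro exI[of _ ?L]) auto
qed

text \<open>Insertability passes to superlists, so the vertices of \<open>W\<close> can be inserted
  one at a time, each into a list that accepts it; stopping after \<open>t\<close> steps gives every
  intermediate length.\<close>

lemma two_path_insertion:
  assumes "finite W" "t \<le> card W"
    and "\<And>w. w \<in> W \<Longrightarrow> insertable E w L1 \<or> insertable E w L2"
    and "successively E L1" "successively E L2" "distinct (L2 @ L1)"
    and "W \<inter> set (L2 @ L1) = {}"
    and "\<And>w v. w \<in> W \<Longrightarrow> v \<in> W \<union> set (L2 @ L1) \<Longrightarrow> v \<noteq> w \<Longrightarrow> E v w \<or> E w v"
  shows "\<exists>L1' L2'. successively E L1' \<and> successively E L2' \<and> distinct (L2' @ L1') \<and>
     hd L1' = hd L1 \<and> last L1' = last L1 \<and> hd L2' = hd L2 \<and> last L2' = last L2 \<and>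
     set (L2' @ L1') \<subseteq> W \<union> set (L2 @ L1) \<and> length (L2' @ L1') = length (L2 @ L1) + t \<and>
     (L1 \<noteq> [] \<longrightarrow> L1' \<noteq> []) \<and> (L2 \<noteq> [] \<longrightarrow> L2' \<noteq> [])"
  using assms
proof (induction t arbitrary: W L1 L2)
  case 0
  then show ?case by auto
next
  case (Suc t)
  then obtain w where w: "w \<in> W" by fastforce
  have fin: "finite (W - {w})" "t \<le> card (W - {w})" using Suc.prems w by auto
  have cmp: "\<And>v. v \<in> set L1 \<Longrightarrow> E v w \<or> E w v" "\<And>v. v \<in> set L2 \<Longrightarrow> E v w \<or> E w v"
    using Suc.prems(7,8) w by (metis UnCI disjoint_iff set_append)+
  from Suc.prems(3)[OF w] show ?case
  proof
    assume "insertable E w L1"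
    from insert_vertex[OF this cmp(1) Suc.prems(4)] obtain K where
      K: "successively E K" "subseq L1 K" "hd K = hd L1" "last K = last L1"
        "mset K = add_mset w (mset L1)" by blast
    have sK: "set K = insert w (set L1)" using K(5) by (metis set_mset_add_mset_insert set_mset_mset)
    have lK: "length K = Suc (length L1)" using K(5) by (metis size_add_mset size_mset)
    have dK: "distinct (L2 @ K)"
    proof -
      have "mset (L2 @ K) = mset (w # L2 @ L1)" using K(5) by simp
      then have "distinct (L2 @ K) \<longleftrightarrow> distinct (w # L2 @ L1)" by (rule mset_eq_imp_distinct_iff)
      then show ?thesis using Suc.prems(6,7) w by auto
    qed
    have "\<exists>L1' L2'. successively E L1' \<and> successively E L2' \<and> distinct (L2' @ L1') \<and>
     hd L1' = hd K \<and> last L1' = last K \<and> hd L2' = hd L2 \<and> last L2' = last L2 \<and>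
     set (L2' @ L1') \<subseteq> (W - {w}) \<union> set (L2 @ K) \<and> length (L2' @ L1') = length (L2 @ K) + t \<and>
     (K \<noteq> [] \<longrightarrow> L1' \<noteq> []) \<and> (L2 \<noteq> [] \<longrightarrow> L2' \<noteq> [])"
    proof (rule Suc.IH[OF fin _ K(1) Suc.prems(5) dK])
      fix w' assume "w' \<in> W - {w}"
      then show "insertable E w' K \<or> insertable E w' L2"
        using Suc.prems(3)[of w'] insertable_subseq[OF _ K(2)] by blast
    next
      show "(W - {w}) \<inter> set (L2 @ K) = {}" using Suc.prems(7) sK by auto
    next
      fix w' v assume "w' \<in> W - {w}" "v \<in> W - {w} \<union> set (L2 @ K)" "v \<noteq> w'"
      then show "E v w' \<or> E w' v" using Suc.prems(8)[of w' v] sK w by auto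
    qed
    then show ?thesis using K(3,4) sK lK w by (elim ex_forward) (auto 0 3)
  next
    assume "insertable E w L2"
    from insert_vertex[OF this cmp(2) Suc.prems(5)] obtain K where
      K: "successively E K" "subseq L2 K" "hd K = hd L2" "last K = last L2"
        "mset K = add_mset w (mset L2)" by blast
    have sK: "set K = insert w (set L2)" using K(5) by (metis set_mset_add_mset_insert set_mset_mset)
    have lK: "length K = Suc (length L2)" using K(5) by (metis size_add_mset size_mset)
    have dK: "distinct (K @ L1)"
    proof -
      have "mset (K @ L1) = mset (w # L2 @ L1)" using K(5) by simp
      then have "distinct (K @ L1) \<longleftrightarrow> distinct (w # L2 @ L1)" by (rule mset_eq_imp_distinct_iff)
      then show ?thesis using Suc.prems(6,7) w by auto
    qed
    have "\<exists>L1' L2'. successively E L1' \<and> successively E L2' \<and> distinct (L2' @ L1') \<and>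
     hd L1' = hd L1 \<and> last L1' = last L1 \<and> hd L2' = hd K \<and> last L2' = last K \<and>
     set (L2' @ L1') \<subseteq> (W - {w}) \<union> set (K @ L1) \<and> length (L2' @ L1') = length (K @ L1) + t \<and>
     (L1 \<noteq> [] \<longrightarrow> L1' \<noteq> []) \<and> (K \<noteq> [] \<longrightarrow> L2' \<noteq> [])"
    proof (rule Suc.IH[OF fin _ Suc.prems(4) K(1) dK])
      fix w' assume "w' \<in> W - {w}"
      then show "insertable E w' L1 \<or> insertable E w' K"
        using Suc.prems(3)[of w'] insertable_subseq[OF _ K(2)] by blast
    next
      show "(W - {w}) \<inter> set (K @ L1) = {}" using Suc.prems(7) sK by auto
    next
      fix w' v assume "w' \<in> W - {w}" "v \<in> W - {w} \<union> set (K @ L1)" "v \<noteq> w'"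
      then show "E v w' \<or> E w' v" using Suc.prems(8)[of w' v] sK w by auto
    qed
    then show ?thesis using K(3,4) sK lK w by (elim ex_forward) (auto 0 3)
  qed
qed

section \<open>Pancyclic arcs of a Hamiltonian cycle of a tournament\<close>

text \<open>Indexing by all of \<open>nat\<close> with period \<open>n\<close> avoids modular
  arithmetic: any \<open>n\<close> consecutive indices enumerate the vertices, and a chord is given
  by its start and its span.\<close>

locale hamiltonian_tournament =
  fixes E :: "'a \<Rightarrow> 'a \<Rightarrow> bool" and x :: "nat \<Rightarrow> 'a" and n :: nat
  assumes n3: "3 \<le> n" and inj: "inj_on x {..<n}" and per: "\<And>i. x (i + n) = x i"
    and arc: "\<And>i. E (x i) (x (Suc i))"
    and tour: "\<And>u v. u \<in> x ` {..<n} \<Longrightarrow> v \<in> x ` {..<n} \<Longrightarrow> u \<noteq> v \<Longrightarrow> E u v \<longleftrightarrow> \<not> E v u"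
begin

abbreviation W :: "'a set" where "W \<equiv> x ` {..<n}"

abbreviation e :: "nat \<Rightarrow> nat \<Rightarrow> bool" where "e i j \<equiv> E (x i) (x j)"

text \<open>Arcs of the cycle are counted by their tails, as each vertex is the tail of exactly one
  of them.\<close>

definition tails :: "'a set" where
  "tails = {v. \<exists>i. v = x i \<and> pancyclic_pair E W (x i) (x (Suc i))}"

lemma card_W: "card W = n" using card_image[OF inj] by simp

lemma per_mult: "x (i + k * n) = x i"
proof (induction k)
  case (Suc k)
  have "x (i + Suc k * n) = x ((i + k * n) + n)" by (simp add: algebra_simps)
  then show ?case using Suc per by simp
qed simp

lemma x_mod: "x (i mod n) = x i"
  using per_mult[of "i mod n" "i div n"] by (simp add: mult.commute)

lemma x_in: "x i \<in> W"
proof -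
  have "x (i mod n) \<in> W" using n3 by (intro imageI) simp
  then show ?thesis by (simp add: x_mod)
qed

lemma tails_sub: "tails \<subseteq> W" unfolding tails_def using x_in by blast

lemma finite_tails: "finite tails" using tails_sub finite_subset by blast

lemma x_neq: assumes "i < j" "j < i + n" shows "x i \<noteq> x j"
proof
  assume "x i = x j"
  then have "x (i mod n) = x (j mod n)" by (simp add: x_mod)
  then have "i mod n = j mod n" using inj n3 by (auto simp: inj_on_def)
  then have "n dvd j - i" using assms mod_eq_dvd_iff_nat[of i j n] by simp
  then show False using assms by (auto dest: dvd_imp_le)
qed

lemma inj_window: "inj_on x {c..<c + n}"
proof (rule inj_onI)
  fix i j assume "i \<in> {c..<c + n}" "j \<in> {c..<c + n}" "x i = x j"
  then show "i = j" using x_neq[of i j] x_neq[of j i] by (cases i j rule: linorder_cases) auto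
qed

lemma tour_idx: assumes "i < j" "j < i + n" shows "e i j \<longleftrightarrow> \<not> e j i"
  using tour[OF x_in x_in x_neq[OF assms]] .

lemma path_idx:
  assumes "js \<noteq> []" "distinct js" "set js \<subseteq> {c..<c + n}" "successively e js" "x ` set js \<subseteq> U"
  shows "has_path E U (x (hd js)) (x (last js)) (length js)"
  unfolding has_path_def
proof (intro exI[of _ "map x js"] conjI)
  show "distinct (map x js)"
    using assms inj_window[of c] by (auto simp: distinct_map intro: inj_on_subset)
qed (use assms in \<open>auto simp: hd_map last_map successively_map\<close>)

lemma succ_upt: "successively e [a..<b]"
proof (induction b)
  case (Suc b)
  then show ?case using arc[of "b - 1"]
    by (cases "a < b") (auto simp: successively_append_iff upt_Suc_append)
qed simp

lemma full: "has_path E W (x (Suc i)) (x i) n"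
proof -
  have "has_path E W (x (hd [Suc i..<Suc i + n])) (x (last [Suc i..<Suc i + n]))
      (length [Suc i..<Suc i + n])"
    by (rule path_idx[of _ "Suc i", OF _ _ _ succ_upt]) (use n3 x_in in auto)
  moreover have "last [Suc i..<Suc i + n] = i + n" "hd [Suc i..<Suc i + n] = Suc i"
      "length [Suc i..<Suc i + n] = n"
    using n3 last_upt[of "Suc i" "Suc i + n"] hd_upt[of "Suc i" "Suc i + n"]
      length_upt[of "Suc i" "Suc i + n"] by linarith+
  ultimately show ?thesis using per by metis
qed

end

text \<open>The bound \<open>d + 2 <= n\<close> leaves at least three vertices on the cycle
  shortened by the chord; \<open>bwd\<close> expresses the minimality of \<open>d\<close> among all
  forward chords.\<close>

locale minimal_chord = hamiltonian_tournament +
  fixes d :: nat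
  assumes d2: "2 \<le> d" and dn: "d + 2 \<le> n" and chord: "E (x 0) (x d)"
    and bwd: "\<And>i s. 2 \<le> s \<Longrightarrow> s < d \<Longrightarrow> E (x (i + s)) (x i)"
begin

section \<open>Cycles of length at most \<open>d + 1\<close> through an arbitrary arc\<close>

lemma bwd': "i + 2 \<le> j \<Longrightarrow> j < i + d \<Longrightarrow> e j i"
  using bwd[of "j - i" i] by simp

lemma x_n: "x n = x 0" using per[of 0] by simp

lemma chord': "e n d" using chord x_n by simp

text \<open>The backward chord of span \<open>l - 1\<close> closes \<open>l\<close> consecutive
  vertices to a cycle.\<close>

lemma short:
  assumes "3 \<le> l" "l \<le> d" shows "has_path E W (x (Suc i)) (x i) l"
proof -
  let ?js = "[Suc i..<i + l] @ [i]"
  have "has_path E W (x (hd ?js)) (x (last ?js)) (length ?js)"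
  proof (rule path_idx[of _ i])
    have "e (i + l - 1) i" using bwd[of "l - 1" i] assms by simp
    then show "successively e ?js"
      using assms by (auto simp: successively_append_iff succ_upt)
  qed (use assms x_in dn in auto)
  then show ?thesis using assms by (simp add: hd_append)
qed

text \<open>Length \<open>d + 1\<close> calls for a chord of span \<open>d\<close>, whose direction
  is unknown. Backward, it closes \<open>d + 1\<close> consecutive vertices from \<open>j\<close>
  on.\<close>

lemma short1:
  assumes "3 \<le> d" "1 \<le> i" shows "has_path E W (x (Suc i)) (x i) (Suc d)"
proof -
  define j where "j = i - 1"
  have i: "i = Suc j" using assms j_def by simp
  show ?thesis
  proof (cases "e (j + d) j")
    case True
    let ?js = "[j + 2..<j + Suc d] @ [j..<j + 2]"
    have "has_path E W (x (hd ?js)) (x (last ?js)) (length ?js)"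
    proof (rule path_idx[of _ j])
      show "successively e ?js"
        using assms True succ_upt[of j "j + 2"] succ_upt[of "j + 2" "j + Suc d"]
        by (auto simp: successively_append_iff)
    qed (use assms x_in dn in auto)
    moreover have "length ?js = Suc d" "hd ?js = Suc i" "last ?js = i"
      using assms i by (simp_all add: hd_append)
    ultimately show ?thesis by (simp only:)
  next
    case False
    then have f: "e j (j + d)" using tour_idx[of j "j + d"] d2 dn by auto
    \<comment> \<open>The forward chord is used together with the backward chords into
      \<open>j\<close> and out of \<open>j + d\<close>. Both have span \<open>d - 1\<close>, hence
      the assumption \<open>3 <= d\<close>.\<close>
    let ?js = "[j + 2..<j + d] @ [j, j + d, Suc j]"
    have "has_path E W (x (hd ?js)) (x (last ?js)) (length ?js)"
    proof (rule path_idx[of _ j])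
      have "e (j + d - 1) j" "e (j + d) (Suc j)" using assms by (auto intro!: bwd')
      then show "successively e ?js"
        using assms f succ_upt[of "j + 2" "j + d"]
        by (auto simp: successively_append_iff)
    qed (use assms x_in dn in auto)
    moreover have "length ?js = Suc d" "hd ?js = Suc i" "last ?js = i"
      using assms i by (simp_all add: hd_append)
    ultimately show ?thesis by (simp only:)
  qed
qed

lemma short_all:
  assumes "3 \<le> d" "3 \<le> l" "l \<le> Suc d" shows "has_path E W (x (Suc i)) (x i) l"
proof (cases "l = Suc d")
  case True
  then show ?thesis using short1[OF assms(1), of "i + n"] n3 per[of i] per[of "Suc i"] by simp
next
  case False
  then show ?thesis using short assms by simp
qed

text \<open>Replacing \<open>x\<^sub>0, \<dots>, x\<^sub>d\<close> by the chord leaves a cycle of length \<open>n - d + 1\<close>. Cutting it at the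
  arc leaving \<open>x\<^sub>k\<close> gives the two segments \<open>R1 k\<close> and \<open>R2 k\<close>, into which vertices skipped by the chord
  are inserted in order to find the long cycles through that arc. Vertex \<open>0\<close> appears as \<open>n\<close>.\<close>

definition R1 :: "nat \<Rightarrow> nat list" where "R1 k = [d..<Suc k]"
definition R2 :: "nat \<Rightarrow> nat list" where "R2 k = [Suc k..<Suc n]"

text \<open>The lengths \<open>n - d + 1\<close> to \<open>n - 1\<close>. Up to
  \<open>n - d + 1\<close> the shortened cycle is available, and length \<open>n\<close> is always
  given by \<open>full\<close>.\<close>

definition long :: "nat \<Rightarrow> bool" where
  "long k \<longleftrightarrow> (\<forall>t\<le>d - 2. has_path E W (x (Suc k)) (x k) (n - d + 1 + t))"

definition blocked :: "nat \<Rightarrow> nat \<Rightarrow> bool" where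
  "blocked k c \<longleftrightarrow> \<not> insertable e c (R1 k) \<and> \<not> insertable e c (R2 k)"

text \<open>A bridge is the configuration in which the insertion may fail; then the skipped arcs between
  \<open>c\<close> and \<open>c'\<close> take over, as they can be entered from anywhere in \<open>R1 k\<close> and left to anywhere in \<open>R2 k\<close>.\<close>

definition bridge :: "nat \<Rightarrow> nat \<Rightarrow> nat \<Rightarrow> bool" where
  "bridge k c c' \<longleftrightarrow> 1 \<le> c \<and> c < c' \<and> c' < d \<and> d \<le> c' - c + 3 \<and>
     (\<forall>a\<in>{d..k}. e a c) \<and> (\<forall>b\<in>{Suc k..n}. e c' b)"

section \<open>Inserting the skipped vertices into the two segments\<close>

lemma comparable:
  assumes "i \<in> {1..n}" "j \<in> {1..n}" "i \<noteq> j" shows "e i j \<or> e j i"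
  using assms tour_idx[of i j] tour_idx[of j i] by (cases i j rule: linorder_cases) auto

lemma inner_in: "2 \<le> c \<Longrightarrow> c < d \<Longrightarrow> e c n"
  using bwd'[of 0 c] x_n by simp

lemma inner_out: "1 \<le> c \<Longrightarrow> c + 2 \<le> d \<Longrightarrow> e d c"
  by (rule bwd') auto

lemma path_of_two:
  assumes "successively e L1" "successively e L2" "distinct (L2 @ L1)" "set (L2 @ L1) \<subseteq> {1..n}"
    "hd L2 = Suc k" "last L2 = n" "hd L1 = d" "last L1 = k" "length (L2 @ L1) = l" "d \<le> k"
    "L1 \<noteq> []" "L2 \<noteq> []"
  shows "has_path E W (x (Suc k)) (x k) l"
proof -
  have "has_path E W (x (hd (L2 @ L1))) (x (last (L2 @ L1))) (length (L2 @ L1))"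
  proof (rule path_idx[of _ 1])
    show "successively e (L2 @ L1)" using assms chord' by (auto simp: successively_append_iff)
  qed (use assms x_in in auto)
  then show ?thesis using assms by simp
qed

lemma extend:
  assumes "successively e L1" "successively e L2" "distinct (L2 @ L1)" "set (L2 @ L1) \<subseteq> {1..n}"
    "hd L2 = Suc k" "last L2 = n" "hd L1 = d" "last L1 = k" "d \<le> k" "L1 \<noteq> []" "L2 \<noteq> []"
    "W' \<subseteq> {1..<d}" "W' \<inter> set (L2 @ L1) = {}" "t \<le> card W'"
    "\<And>w. w \<in> W' \<Longrightarrow> insertable e w L1 \<or> insertable e w L2"
  shows "has_path E W (x (Suc k)) (x k) (length (L2 @ L1) + t)"
proof -
  have fin: "finite W'" using assms(12) finite_subset by blast
  have sub: "W' \<union> set (L2 @ L1) \<subseteq> {1..n}" using assms(4,12) dn by fastforce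
  have cmp: "e v w \<or> e w v" if "w \<in> W'" "v \<in> W' \<union> set (L2 @ L1)" "v \<noteq> w" for w v
    using comparable[of v w] that sub by blast
  obtain L1' L2' where L: "successively e L1'" "successively e L2'" "distinct (L2' @ L1')"
     "hd L1' = hd L1" "last L1' = last L1" "hd L2' = hd L2" "last L2' = last L2"
     "set (L2' @ L1') \<subseteq> W' \<union> set (L2 @ L1)" "length (L2' @ L1') = length (L2 @ L1) + t"
     "L1' \<noteq> []" "L2' \<noteq> []"
    using two_path_insertion[OF fin assms(14) assms(15) assms(1-3) assms(13) cmp] assms(10,11)
    by blast
  show ?thesis
    by (rule path_of_two[of L1' L2']) (use L assms sub in auto)
qed


lemma R_facts:
  assumes "d \<le> k" "k < n"
  shows "successively e (R1 k)" "successively e (R2 k)" "distinct (R2 k @ R1 k)"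
    "set (R2 k @ R1 k) \<subseteq> {1..n}" "hd (R2 k) = Suc k" "last (R2 k) = n" "hd (R1 k) = d"
    "last (R1 k) = k" "R1 k \<noteq> []" "R2 k \<noteq> []" "length (R2 k @ R1 k) = n - d + 1"
    "set (R2 k @ R1 k) = {d..n}"
proof -
  show "last (R1 k) = k" "last (R2 k) = n" "hd (R2 k) = Suc k" "hd (R1 k) = d"
    using assms by (simp_all add: R1_def R2_def hd_append)
qed (use assms d2 succ_upt in \<open>auto simp: R1_def R2_def simp del: upt_Suc\<close>)

lemma insertable_R1:
  "d \<le> u \<Longrightarrow> u < v \<Longrightarrow> v \<le> k \<Longrightarrow> e u c \<Longrightarrow> e c v \<Longrightarrow> insertable e c (R1 k)"
  unfolding R1_def by (rule insertable_upt) auto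

lemma insertable_R2:
  "Suc k \<le> u \<Longrightarrow> u < v \<Longrightarrow> v \<le> n \<Longrightarrow> e u c \<Longrightarrow> e c v \<Longrightarrow> insertable e c (R2 k)"
  unfolding R2_def by (rule insertable_upt) auto

text \<open>With at most one blocked vertex, \<open>d - 2\<close> of the \<open>d - 1\<close>
  skipped ones are insertable, enough for every length up to \<open>n - 1\<close>.\<close>

lemma blocked_card:
  assumes k: "d \<le> k" "k < n" and "\<not> long k"
  shows "2 \<le> card {c \<in> {1..<d}. blocked k c}"
proof (rule ccontr)
  assume less: "\<not> 2 \<le> card {c \<in> {1..<d}. blocked k c}"
  let ?I = "{c \<in> {1..<d}. \<not> blocked k c}"
  have "card ?I + card {c \<in> {1..<d}. blocked k c} = card {1..<d}"
  proof (subst card_Un_disjoint[symmetric])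
    show "card (?I \<union> {c \<in> {1..<d}. blocked k c}) = card {1..<d}"
      by (rule arg_cong[of _ _ card]) auto
  qed auto
  with less have cI: "d - 2 \<le> card ?I" by simp
  have "long k"
    unfolding long_def
  proof (intro allI impI)
    fix t assume t: "t \<le> d - 2"
    have "has_path E W (x (Suc k)) (x k) (length (R2 k @ R1 k) + t)"
    proof (rule extend[of "R1 k" "R2 k" k ?I])
      show "?I \<inter> set (R2 k @ R1 k) = {}" unfolding R_facts(12)[OF k] by auto
      show "t \<le> card ?I" using t cI by simp
    qed (use R_facts[OF k] k d2 in \<open>auto simp: blocked_def\<close>)
    then show "has_path E W (x (Suc k)) (x k) (n - d + 1 + t)" using R_facts[OF k] by simp
  qed
  then show False using assms by simp
qed

text \<open>Minimality of \<open>d\<close> makes \<open>d\<close> point to \<open>c\<close> and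
  \<open>c\<close> point to \<open>n\<close>, so a wrong direction at \<open>k\<close> or at
  \<open>Suc k\<close> would allow an insertion. The exceptions \<open>c = d - 1\<close> and
  \<open>c = 1\<close>, adjacent to the ends of the chord, use \<open>Suc d\<close> and
  \<open>n - 1\<close> instead.\<close>

lemma blocked_switch:
  assumes k: "d \<le> k" "k < n" and c: "1 \<le> c" "c < d" and b: "blocked k c" and "3 \<le> d"
  shows "e k c" "e c (Suc k)"
proof -
  note nR1 = insertable_R1[of _ _ k c] and nR2 = insertable_R2[of k _ _ c]
  have b': "\<not> insertable e c (R1 k)" "\<not> insertable e c (R2 k)" using b blocked_def by auto
  have cmp: "e i c \<or> e c i" if "i \<in> {d..n}" for i
    using comparable[of i c] that c by auto
  show "e k c"
  proof (rule ccontr)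
    assume "\<not> e k c"
    then have ck: "e c k" using cmp[of k] k by auto
    show False
    proof (cases "c + 2 \<le> d")
      case True
      then have "e d c" using inner_out c by simp
      moreover have "k \<noteq> d" using \<open>\<not> e k c\<close> calculation by auto
      ultimately show False using nR1[of d k] k ck b' by simp
    next
      case False
      then have "e (Suc d) c" using bwd'[of c "Suc d"] c \<open>3 \<le> d\<close> by simp
      show False
      proof (cases "k = d")
        case True
        then show False using nR2[of "Suc d" n] \<open>e (Suc d) c\<close> dn b' inner_in[of c] c False assms(6) by simp
      next
        case kd: False
        moreover have "k \<noteq> Suc d" using \<open>\<not> e k c\<close> \<open>e (Suc d) c\<close> by auto
        ultimately show False using nR1[of "Suc d" k] k ck b' \<open>e (Suc d) c\<close> by simp
      qed
    qed
  qed
  show "e c (Suc k)"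
  proof (rule ccontr)
    assume "\<not> e c (Suc k)"
    then have ck: "e (Suc k) c" using cmp[of "Suc k"] k by auto
    show False
    proof (cases "2 \<le> c")
      case True
      then have "e c n" using inner_in c by simp
      moreover have "Suc k \<noteq> n" using \<open>\<not> e c (Suc k)\<close> calculation by auto
      ultimately show False using nR2[of "Suc k" n] k ck b' by simp
    next
      case False
      then have c1: "c = 1" using c by simp
      have "e (1 + n) (n - 1)" using bwd'[of "n - 1" "1 + n"] \<open>3 \<le> d\<close> n3 by simp
      then have o: "e c (n - 1)" using per[of 1] c1 by (simp add: add.commute)
      show False
      proof (cases "Suc k = n")
        case True
        then have "d < n - 1" "n - 1 \<le> k" using dn by auto
        then show False using nR1[of d "n - 1"] o b' inner_out[of c] c1 assms(6) by simp
      next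
        case kd: False
        moreover have "Suc k \<noteq> n - 1" using \<open>\<not> e c (Suc k)\<close> o by auto
        moreover from calculation have "Suc k < n - 1" using k by linarith
        ultimately show False using nR2[of "Suc k" "n - 1"] k ck b' o by simp
      qed
    qed
  qed
qed

text \<open>The place \<open>k\<close>, \<open>Suc k\<close> where \<open>c\<close> switches
  direction lies inside \<open>R1 k'\<close>, so \<open>c\<close> is insertable there.\<close>

lemma blocked_unique_aux:
  assumes "d \<le> k" "k < k'" "k' < n" "1 \<le> c" "c < d" "3 \<le> d" "blocked k c" "blocked k' c"
  shows False
proof -
  have "e k c" "e c (Suc k)" using blocked_switch[of k c] assms by auto
  then have "insertable e c (R1 k')" using insertable_R1[of k "Suc k" k' c] assms by simp
  then show False using assms blocked_def by simp
qed

lemma blocked_unique: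
  assumes "k \<in> {d..<n}" "k' \<in> {d..<n}" "k \<noteq> k'" "3 \<le> d"
  shows "{c \<in> {1..<d}. blocked k c} \<inter> {c \<in> {1..<d}. blocked k' c} = {}"
  using assms blocked_unique_aux[of k k'] blocked_unique_aux[of k' k]
  by (cases k k' rule: linorder_cases) auto

text \<open>The cycle runs through \<open>c..c'\<close>, a final part of \<open>R2 k\<close>, the
  chord, an initial part of \<open>R1 k\<close>, and back to \<open>c\<close>. The bridge lets these
  two parts have any lengths, which adjusts the total to \<open>l\<close>.\<close>

lemma bridge_path:
  assumes k: "d \<le> k" "k < n" and br: "bridge k c c'" and l: "Suc d \<le> l" "l \<le> n - 1"
    and j: "c \<le> j" "j < c'"
  shows "has_path E W (x (Suc j)) (x j) l"
proof -
  have br': "1 \<le> c" "c < c'" "c' < d" "d \<le> c' - c + 3" "\<And>a. a\<in>{d..k} \<Longrightarrow> e a c"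
     "\<And>b. b\<in>{Suc k..n} \<Longrightarrow> e c' b"
    using br unfolding bridge_def by auto
  \<comment> \<open>The number of vertices to take from \<open>d..n\<close>: at least two because
    \<open>c' - c + 1 < d\<close>, and at most \<open>n - d + 1\<close> because of the 3 in
    \<open>bridge\<close>. As many as possible come from \<open>R1 k\<close>, while at least one is
    left for \<open>R2 k\<close>.\<close>
  define q where "q = l - (c' - c + 1)"
  define a where "a = d + min (q - 2) (k - d)"
  define b where "b = n + 1 - (q - (a - d + 1))"
  have q: "2 \<le> q" "q \<le> n - d + 1" "l = q + (c' - c + 1)" using br' l q_def by auto
  have a: "d \<le> a" "a \<le> k" using a_def k by auto
  have b: "Suc k \<le> b" "b \<le> n" using a_def b_def q k by (auto simp: min_def split: if_splits)
  have len: "(n + 1 - b) + (a + 1 - d) = q"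
    using a_def b_def q k by (auto simp: min_def split: if_splits)
  let ?js = "[Suc j..<Suc c'] @ [b..<Suc n] @ [d..<Suc a] @ [c..<Suc j]"
  have "has_path E W (x (hd ?js)) (x (last ?js)) (length ?js)"
  proof (rule path_idx[of _ 1])
    have "e c' b" "e a c" using br'(5,6) a b k by auto
    then show "successively e ?js"
      using a b k j br' succ_upt chord'
      by (auto simp: successively_append_iff hd_append last_append simp del: upt_Suc)
    show "distinct ?js" using a b k j br' by (auto simp del: upt_Suc)
    show "set ?js \<subseteq> {1..<1 + n}" using a b k j br' by (auto simp del: upt_Suc)
    show "?js \<noteq> []" using j by (simp del: upt_Suc)
    show "x ` set ?js \<subseteq> W" using x_in by blast
  qed
  moreover have "length ?js = l" using len q j br' a b k by (simp del: upt_Suc)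
  moreover have "hd ?js = Suc j" "last ?js = j" using j by (simp_all add: hd_append last_append del: upt_Suc)
  ultimately show ?thesis by simp
qed

lemma bridge_pancyclic:
  assumes "d \<le> k" "k < n" "bridge k c c'" "c \<le> j" "j < c'"
  shows "pancyclic_pair E W (x j) (x (Suc j))"
  unfolding pancyclic_pair_def card_W
proof
  fix l assume "l \<in> {3..n}"
  moreover have "3 \<le> d" using assms(3) by (auto simp: bridge_def)
  ultimately show "has_path E W (x (Suc j)) (x j) l"
    using short_all[of l j] bridge_path[OF assms(1-3), of l j] full[of j] assms
    by (cases "l \<le> Suc d"; cases "l = n") auto
qed

end

context minimal_chord
begin

text \<open>If \<open>1\<close> and \<open>d - 1\<close> form no bridge, one of them can be
  inserted. Together with one end of the chord it then encloses all but two of the other skipped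
  vertices. Either one of these two is insertable, which suffices, or both are blocked and a bridge
  arises whose span is smaller by one.\<close>

lemma long_or_bridge:
  assumes k: "d \<le> k" "k < n" and d3: "3 \<le> d"
  shows "long k \<or> (\<exists>c c'. bridge k c c')"
proof -
  have base: "has_path E W (x (Suc k)) (x k) (n - d + 1)"
    using path_of_two R_facts[OF k] k(1) by metis
  have longI: "long k" if "\<And>t. t \<le> d - 3 \<Longrightarrow> has_path E W (x (Suc k)) (x k) (n - d + 1 + Suc t)"
    unfolding long_def
  proof (intro allI impI)
    fix t assume "t \<le> d - 2"
    then show "has_path E W (x (Suc k)) (x k) (n - d + 1 + t)"
      using base that[of "t - 1"] by (cases t) auto
  qed
  have cmp: "e i c \<or> e c i" if "i \<in> {d..n}" "1 \<le> c" "c < d" for i c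
    using comparable[of i c] that by auto
  have outR1: "e a c" if "1 \<le> c" "c + 2 \<le> d" "blocked k c" "a \<in> {d..k}" for a c
  proof (rule ccontr)
    assume "\<not> e a c"
    moreover from this have "e c a" using cmp[of a c] that k by auto
    moreover have "e d c" using inner_out that by simp
    moreover from calculation have "a \<noteq> d" by auto
    ultimately show False using that insertable_R1[of d a k c] by (auto simp: blocked_def)
  qed
  have inR2: "e c b" if "2 \<le> c" "c < d" "blocked k c" "b \<in> {Suc k..n}" for b c
  proof (rule ccontr)
    assume "\<not> e c b"
    moreover from this have "e b c" using cmp[of b c] that k by auto
    moreover have "e c n" using inner_in that by simp
    moreover from calculation have "b \<noteq> n" by auto
    ultimately show False using that insertable_R2[of k b n c] by (auto simp: blocked_def)
  qed
  consider "\<forall>a\<in>{d..k}. e a 1" "\<forall>b\<in>{Suc k..n}. e (d - 1) b"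
    | a where "a \<in> {d..k}" "\<not> e a 1" | b where "b \<in> {Suc k..n}" "\<not> e (d - 1) b"
    by blast
  then show ?thesis
  proof cases
    case 1
    then have "bridge k 1 (d - 1)" using d3 by (simp add: bridge_def)
    then show ?thesis by blast
  next
    case 2
    have "e 1 a" "e d 1" using cmp[of a 1] 2 k d3 inner_out[of 1] by auto
    moreover from this 2 have "a \<noteq> d" by auto
    ultimately have ins: "insertable e 1 (R1 k)" using insertable_R1[of d a k 1] 2 by simp
    have "e v 1 \<or> e 1 v" if "v \<in> set (R1 k)" for v
    proof -
      have "v \<in> {d..n}" using that R_facts(12)[OF k] by auto
      then show ?thesis using cmp[of v 1] d3 by simp
    qed
    from insert_vertex[OF ins this R_facts(1)[OF k]] obtain L where
      L: "successively e L" "subseq (R1 k) L" "hd L = d" "last L = k"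
        "mset L = add_mset 1 (mset (R1 k))" "subseq [d, 1] L"
      using R_facts(7,8)[OF k] by auto
    have sL: "set L = insert 1 (set (R1 k))" using L(5) by (metis set_mset_add_mset_insert set_mset_mset)
    have ms: "mset (R2 k @ L) = mset (1 # R2 k @ R1 k)" using L(5) by simp
    have dL: "distinct (R2 k @ L)"
      unfolding mset_eq_imp_distinct_iff[OF ms] distinct.simps(2) R_facts(12)[OF k]
      using R_facts(3)[OF k] d3 by auto
    have lL: "length (R2 k @ L) = n - d + 2"
      using mset_eq_length[OF ms] R_facts(11)[OF k] by simp
    \<comment> \<open>One skipped vertex is already in \<open>L\<close>, so \<open>d - 3\<close>
      more reach length \<open>n - 1\<close>.\<close>
    have main: "long k" if W': "W' \<subseteq> {2..<d}" "card W' = d - 3"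
      "\<And>w. w \<in> W' \<Longrightarrow> insertable e w L \<or> insertable e w (R2 k)" for W'
    proof (rule longI)
      fix t assume t: "t \<le> d - 3"
      have "has_path E W (x (Suc k)) (x k) (length (R2 k @ L) + t)"
      proof (rule extend[OF L(1) R_facts(2)[OF k] dL])
        show "set (R2 k @ L) \<subseteq> {1..n}" using R_facts(4)[OF k] sL n3 by auto
        show "W' \<inter> set (R2 k @ L) = {}" using W'(1) sL R_facts(12)[OF k] by fastforce
        show "L \<noteq> []" using sL by auto
      qed (use R_facts[OF k] k L W' t in auto)
      then show "has_path E W (x (Suc k)) (x k) (n - d + 1 + Suc t)" using lL by simp
    qed
    \<comment> \<open>In \<open>L\<close>, \<open>d\<close> comes before \<open>1\<close>, and the
      pairs \<open>d\<close>, \<open>w\<close> and \<open>w\<close>, \<open>1\<close> are backward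
      chords. Only \<open>2\<close> and \<open>d - 1\<close> escape this.\<close>
    have mid: "insertable e w L" if "3 \<le> w" "w + 2 \<le> d" for w
      unfolding insertable_def using L(6) inner_out[of w] bwd'[of 1 w] that by auto
    have lift: "insertable e w L \<or> insertable e w (R2 k)" if "\<not> blocked k w" for w
      using that insertable_subseq[OF _ L(2)] by (auto simp: blocked_def)
    consider "d = 3" | "4 \<le> d" "\<not> blocked k 2" | "4 \<le> d" "\<not> blocked k (d - 1)"
      | "4 \<le> d" "blocked k 2" "blocked k (d - 1)" using d3 by linarith
    then show ?thesis
    proof cases
      case 1
      then show ?thesis using main[of "{}"] by simp
    next
      case 2
      have "insertable e w L \<or> insertable e w (R2 k)" if "w \<in> {2..<d - 1}" for w
      proof -
        have "w = 2 \<or> 3 \<le> w \<and> w + 2 \<le> d" using that by auto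
        then show ?thesis using mid[of w] lift[of w] 2 by blast
      qed
      then show ?thesis using main[of "{2..<d - 1}"] by simp
    next
      case 3
      have "insertable e w L \<or> insertable e w (R2 k)" if "w \<in> {3..<d}" for w
      proof -
        have "w = d - 1 \<or> 3 \<le> w \<and> w + 2 \<le> d" using that by auto
        then show ?thesis using mid[of w] lift[of w] 3 by blast
      qed
      then show ?thesis using main[of "{3..<d}"] by simp
    next
      case 4
      then have "bridge k 2 (d - 1)"
        using outR1[of 2] inR2[of "d - 1"] unfolding bridge_def by auto
      then show ?thesis by blast
    qed
  next
    case 3
    \<comment> \<open>The mirror image: \<open>d - 1\<close> enters \<open>R2 k\<close> before
      \<open>n\<close>, and only \<open>1\<close> and \<open>d - 2\<close> escape.\<close>
    have "e b (d - 1)" "e (d - 1) n" using cmp[of b "d - 1"] 3 k d3 inner_in[of "d - 1"] by auto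
    moreover from this 3 have "b \<noteq> n" by auto
    ultimately have ins: "insertable e (d - 1) (R2 k)" using insertable_R2[of k b n "d - 1"] 3 by simp
    have "e v (d - 1) \<or> e (d - 1) v" if "v \<in> set (R2 k)" for v
    proof -
      have "v \<in> {d..n}" using that R_facts(12)[OF k] by auto
      then show ?thesis using cmp[of v "d - 1"] d3 by simp
    qed
    from insert_vertex[OF ins this R_facts(2)[OF k]] obtain L where
      L: "successively e L" "subseq (R2 k) L" "hd L = Suc k" "last L = n"
        "mset L = add_mset (d - 1) (mset (R2 k))" "subseq [d - 1, n] L"
      using R_facts(5,6)[OF k] by auto
    have sL: "set L = insert (d - 1) (set (R2 k))" using L(5) by (metis set_mset_add_mset_insert set_mset_mset)
    have ms: "mset (L @ R1 k) = mset ((d - 1) # R2 k @ R1 k)" using L(5) by simp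
    have dL: "distinct (L @ R1 k)"
      unfolding mset_eq_imp_distinct_iff[OF ms] distinct.simps(2) R_facts(12)[OF k]
      using R_facts(3)[OF k] d3 by auto
    have lL: "length (L @ R1 k) = n - d + 2"
      using mset_eq_length[OF ms] R_facts(11)[OF k] by simp
    have main: "long k" if W': "W' \<subseteq> {1..<d - 1}" "card W' = d - 3"
      "\<And>w. w \<in> W' \<Longrightarrow> insertable e w (R1 k) \<or> insertable e w L" for W'
    proof (rule longI)
      fix t assume t: "t \<le> d - 3"
      have "has_path E W (x (Suc k)) (x k) (length (L @ R1 k) + t)"
      proof (rule extend[OF R_facts(1)[OF k] L(1) dL])
        show "set (L @ R1 k) \<subseteq> {1..n}" using R_facts(4)[OF k] sL n3 d3 dn by auto
        show "W' \<inter> set (L @ R1 k) = {}" using W'(1) sL R_facts(12)[OF k] by fastforce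
        show "L \<noteq> []" using sL by auto
        show "W' \<subseteq> {1..<d}" using W'(1) by fastforce
      qed (use R_facts[OF k] k L W' t in auto)
      then show "has_path E W (x (Suc k)) (x k) (n - d + 1 + Suc t)" using lL by simp
    qed
    have mid: "insertable e w L" if "2 \<le> w" "w + 3 \<le> d" for w
      unfolding insertable_def using L(6) inner_in[of w] bwd'[of w "d - 1"] that
      by (intro exI[of _ "d - 1"] exI[of _ n]) auto
    have lift: "insertable e w (R1 k) \<or> insertable e w L" if "\<not> blocked k w" for w
      using that insertable_subseq[OF _ L(2)] by (auto simp: blocked_def)
    consider "d = 3" | "4 \<le> d" "\<not> blocked k 1" | "4 \<le> d" "\<not> blocked k (d - 2)"
      | "4 \<le> d" "blocked k 1" "blocked k (d - 2)" using d3 by linarith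
    then show ?thesis
    proof cases
      case 1
      then show ?thesis using main[of "{}"] by simp
    next
      case 2
      have "insertable e w (R1 k) \<or> insertable e w L" if "w \<in> {1..<d - 2}" for w
      proof -
        have "w = 1 \<or> 2 \<le> w \<and> w + 3 \<le> d" using that by auto
        then show ?thesis using mid[of w] lift[of w] 2 by blast
      qed
      then show ?thesis using main[of "{1..<d - 2}"] by fastforce
    next
      case 3
      have "insertable e w (R1 k) \<or> insertable e w L" if "w \<in> {2..<d - 1}" for w
      proof -
        have "w = d - 2 \<or> 2 \<le> w \<and> w + 3 \<le> d" using that by auto
        then show ?thesis using mid[of w] lift[of w] 3 by blast
      qed
      then show ?thesis using main[of "{2..<d - 1}"] by fastforce
    next
      case 4
      then have "bridge k 1 (d - 2)"
        using outR1[of 1] inR2[of "d - 2"] unfolding bridge_def by auto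
      then show ?thesis by blast
    qed
  qed
qed

section \<open>The tournament on the cycle shortened by the chord\<close>

abbreviation V0 :: "'a set" where "V0 \<equiv> x ` {d..n}"

lemma card_V0: "card V0 = n - d + 1"
proof -
  have "inj_on x {d..n}"
    using inj_window[of 1] by (rule inj_on_subset) (use d2 in auto)
  then show ?thesis using card_image[of x "{d..n}"] dn by simp
qed

text \<open>Replacing the chord by the path that it cuts off turns a cycle through the chord into
  one through all \<open>d\<close> arcs of that path, with \<open>d - 1\<close> more
  vertices.\<close>

lemma detour:
  assumes "j < d" "has_path E V0 (x d) (x n) l"
  shows "has_path E W (x (Suc j)) (x j) (l + d - 1)"
proof -
  obtain zs where zs: "zs \<noteq> []" "hd zs = x d" "last zs = x n" "distinct zs" "set zs \<subseteq> V0"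
    "length zs = l" "successively E zs" using assms(2) unfolding has_path_def by blast
  let ?A = "map x [Suc j..<d]" and ?B = "map x [1..<Suc j]"
  have in1: "inj_on x {1..n}" using inj_window[of 1] by (rule inj_on_subset) auto
  have disj: "V0 \<inter> x ` {1..<d} = {}"
    using inj_on_image_Int[OF in1, of "{d..n}" "{1..<d}"] d2 dn by fastforce
  have dAB: "distinct (?A @ ?B)"
  proof -
    have "distinct (map x ([Suc j..<d] @ [1..<Suc j]))"
      unfolding distinct_map using assms(1) dn
      by (auto intro!: inj_on_subset[OF in1] simp del: upt_Suc)
    then show ?thesis by simp
  qed
  have sAB: "set (?A @ ?B) \<subseteq> x ` {1..<d}" using assms(1) by (auto simp del: upt_Suc)
  show ?thesis unfolding has_path_def
  proof (intro exI[of _ "?A @ zs @ ?B"] conjI)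
    have "set ?A \<inter> set zs = {}" "set zs \<inter> set ?B = {}"
      using sAB zs(5) disj unfolding set_append by blast+
    then show "distinct (?A @ zs @ ?B)"
      using dAB zs(4) unfolding distinct_append set_append by blast
    show "hd (?A @ zs @ ?B) = x (Suc j)"
      using assms(1) zs(1,2) by (cases "Suc j = d") (auto simp: hd_append hd_map)
    show "last (?A @ zs @ ?B) = x j"
      using zs(1,3) x_n by (cases j) (auto simp: last_append last_map)
    show "set (?A @ zs @ ?B) \<subseteq> W" using zs(5) x_in by auto
    show "length (?A @ zs @ ?B) = l + d - 1" using zs(6) assms(1) by (cases j) auto
    have sA: "successively E ?A" "successively E ?B" using succ_upt by (auto simp: successively_map simp del: upt_Suc)
    have "E (last ?A) (hd (zs @ ?B))" if "?A \<noteq> []"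
      using that zs(1,2) arc[of "d - 1"] by (simp add: last_map)
    moreover have "E (last zs) (hd ?B)" if "?B \<noteq> []"
      using that zs(3) x_n arc[of 0] by (simp add: hd_map del: upt_Suc)
    ultimately show "successively E (?A @ zs @ ?B)"
      using sA zs(7) by (auto simp: successively_append_iff simp del: upt_Suc)
  qed (use zs in auto)
qed


lemma inj1: "inj_on x {1..n}"
  using inj_window[of 1] by (rule inj_on_subset) auto

lemma reduced_tournament:
  defines "m \<equiv> n - d + 1"
  shows "hamiltonian_tournament E (\<lambda>i. x (d + i mod m)) m"
    "(\<lambda>i. x (d + i mod m)) ` {..<m} = V0"
proof -
  have m: "3 \<le> m" "d + m = Suc n" using dn m_def by auto
  have im: "(\<lambda>i. d + i mod m) ` {..<m} = {d..n}"
  proof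
    show "{d..n} \<subseteq> (\<lambda>i. d + i mod m) ` {..<m}"
    proof
      fix i assume "i \<in> {d..n}"
      then have "i = d + (i - d) mod m" "i - d \<in> {..<m}" using m by auto
      then show "i \<in> (\<lambda>i. d + i mod m) ` {..<m}" by blast
    qed
  qed (use m in \<open>auto simp: less_Suc_eq_le[symmetric]\<close>)
  show V: "(\<lambda>i. x (d + i mod m)) ` {..<m} = V0"
    using im by (metis image_image)
  show "hamiltonian_tournament E (\<lambda>i. x (d + i mod m)) m"
  proof
    show "inj_on (\<lambda>i. x (d + i mod m)) {..<m}"
    proof (rule inj_onI)
      fix i j assume ij: "i \<in> {..<m}" "j \<in> {..<m}" "x (d + i mod m) = x (d + j mod m)"
      then have "d + i \<in> {1..n}" "d + j \<in> {1..n}" using m d2 by auto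
      then show "i = j" using ij inj_onD[OF inj1, of "d + i" "d + j"] by simp
    qed
  next
    fix i
    show "E (x (d + i mod m)) (x (d + Suc i mod m))"
    proof (cases "Suc (i mod m) = m")
      case True
      then have "d + i mod m = n" using m by linarith
      then show ?thesis using chord' True by (simp add: mod_Suc)
    next
      case False
      then show ?thesis using arc[of "d + i mod m"] by (simp add: mod_Suc)
    qed
  next
    fix u v assume "u \<in> (\<lambda>i. x (d + i mod m)) ` {..<m}" "v \<in> (\<lambda>i. x (d + i mod m)) ` {..<m}" "u \<noteq> v"
    moreover have "V0 \<subseteq> W" using x_in by auto
    ultimately show "E u v \<longleftrightarrow> \<not> E v u" unfolding V using tour[of u v] by blast
  qed (use m in auto)
qed

text \<open>Index \<open>n\<close> stands for the chord, which leads from \<open>n\<close> to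
  \<open>d\<close>.\<close>

definition reduced_tails :: "nat set" where
  "reduced_tails = {k \<in> {d..n}. pancyclic_pair E V0 (x k) (x (if k = n then d else Suc k))}"

lemma reduced_tails_card:
  assumes "3 \<le> card (hamiltonian_tournament.tails E (\<lambda>i. x (d + i mod (n - d + 1))) (n - d + 1))"
  shows "3 \<le> card reduced_tails"
proof -
  let ?m = "n - d + 1"
  interpret H: hamiltonian_tournament E "\<lambda>i. x (d + i mod ?m)" ?m
    by (rule reduced_tournament)
  have "H.tails \<subseteq> x ` reduced_tails"
  proof
    fix v assume "v \<in> H.tails"
    then obtain i where i: "v = x (d + i mod ?m)"
      "pancyclic_pair E V0 (x (d + i mod ?m)) (x (d + Suc i mod ?m))"
      unfolding H.tails_def reduced_tournament(2) by blast
    define r where "r = i mod ?m"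
    have "r < ?m" unfolding r_def by simp
    then have r: "r \<le> n - d" by simp
    have "Suc i mod ?m = (if r = n - d then 0 else Suc r)"
      unfolding r_def by (simp add: mod_Suc)
    then have "pancyclic_pair E V0 (x (d + r)) (x (if d + r = n then d else Suc (d + r)))"
      using i(2) r dn unfolding r_def[symmetric] by (auto split: if_splits)
    then have "d + i mod ?m \<in> reduced_tails"
      using r dn unfolding r_def[symmetric] reduced_tails_def by auto
    then show "v \<in> x ` reduced_tails" using i by blast
  qed
  moreover have "finite reduced_tails" by (simp add: reduced_tails_def)
  ultimately have "card H.tails \<le> card (x ` reduced_tails)" "card (x ` reduced_tails) \<le> card reduced_tails"
    by (simp_all add: card_mono card_image_le)
  then show ?thesis using assms by simp
qed

section \<open>Transfer of three pancyclic arcs from the shortened cycle\<close>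

lemma tails_intro:
  assumes "\<And>l. 3 \<le> l \<Longrightarrow> l < n \<Longrightarrow> has_path E W (x (Suc k)) (x k) l"
  shows "x k \<in> tails"
proof -
  have "pancyclic_pair E W (x k) (x (Suc k))"
    unfolding pancyclic_pair_def card_W
  proof
    fix l assume "l \<in> {3..n}"
    then show "has_path E W (x (Suc k)) (x k) l"
      using assms[of l] full[of k] by (cases "l = n") auto
  qed
  then show ?thesis unfolding tails_def by blast
qed

lemma card_tails_ge:
  assumes "x ` I \<subseteq> tails" "I \<subseteq> {1..n}" shows "card I \<le> card tails"
  using card_mono[OF finite_tails assms(1)] card_image[OF inj_on_subset[OF inj1 assms(2)]] by simp

lemma reduced_path:
  assumes "k \<in> reduced_tails" "k < n" "3 \<le> l" "l \<le> n - d + 1"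
  shows "has_path E W (x (Suc k)) (x k) l"
proof -
  have "has_path E V0 (x (Suc k)) (x k) l"
    using assms unfolding reduced_tails_def pancyclic_pair_def card_V0 by auto
  then show ?thesis by (rule has_path_mono) (use x_in in auto)
qed

text \<open>Detours give the skipped arcs all lengths from \<open>d + 2\<close> on. For
  \<open>3 <= d\<close> the shorter lengths are known, so \<open>d\<close> arcs are found. For
  \<open>d = 2\<close> only triangles are missing; one of the two skipped arcs lies on one and takes
  the place of the chord in the count.\<close>

lemma three_tails_chord:
  assumes "n \<in> reduced_tails" "3 \<le> card reduced_tails"
  shows "3 \<le> card tails"
proof -
  have ch: "has_path E V0 (x d) (x n) l" if "3 \<le> l" "l \<le> n - d + 1" for l
    using assms(1) that unfolding reduced_tails_def pancyclic_pair_def card_V0 by auto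
  have det: "has_path E W (x (Suc j)) (x j) l" if "j < d" "d + 2 \<le> l" "l \<le> n" for j l
    using detour[OF that(1) ch[of "l - d + 1"]] that by simp
  show ?thesis
  proof (cases "3 \<le> d")
    case True
    have "x j \<in> tails" if "j < d" for j
    proof (rule tails_intro)
      fix l assume "3 \<le> l" "l < n"
      then show "has_path E W (x (Suc j)) (x j) l"
        using short_all[OF True, of l j] det[OF that, of l] by (cases "l \<le> Suc d") auto
    qed
    then have "x ` ({1..<d} \<union> {n}) \<subseteq> tails" using x_n d2 by auto
    then have "card ({1..<d} \<union> {n}) \<le> card tails" using dn by (intro card_tails_ge) auto
    moreover have "card ({1..<d} \<union> {n}) = d" using d2 dn by (subst card_Un_disjoint) auto
    ultimately show ?thesis using True by simp
  next
    case False
    then have d: "d = 2" using d2 by simp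
    obtain zs where zs: "zs \<noteq> []" "hd zs = x d" "last zs = x n" "distinct zs" "set zs \<subseteq> V0"
      "length zs = 3" "successively E zs" 
    proof -
      have "has_path E V0 (x d) (x n) 3" using ch[of 3] dn by simp
      then show ?thesis using that unfolding has_path_def by blast
    qed
    then obtain y where y: "zs = [x 2, y, x 0]"
      using x_n d by (cases zs; cases "tl zs"; cases "tl (tl zs)") auto
    have yV: "y \<in> V0" "E (x 2) y" "E y (x 0)" "y \<noteq> x 2" "y \<noteq> x 0" using zs y by auto
    then have yW: "y \<in> W" using x_in by auto
    have "x 1 \<notin> V0"
      using inj_onD[OF inj1, of 1] d n3 by fastforce
    then have y1: "y \<noteq> x 1" using yV(1) by blast
    have ne: "x 0 \<noteq> x 1" "x 1 \<noteq> x 2" using x_neq[of 0 1] x_neq[of 1 2] n3 by auto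
    \<comment> \<open>Given a triangle \<open>x 0\<close>, \<open>x 2\<close>, \<open>y\<close>
      through the chord, the direction between \<open>x 1\<close> and \<open>y\<close> decides which
      skipped arc lies on a triangle with \<open>y\<close>.\<close>
    have "has_path E W (x 1) (x 0) 3 \<or> has_path E W (x 2) (x 1) 3"
    proof (cases "E (x 1) y")
      case True
      then have "has_path E W (x 1) (x 0) 3" unfolding has_path_def
        by (intro exI[of _ "[x 1, y, x 0]"]) (use yV yW y1 ne x_in in auto)
      then show ?thesis by simp
    next
      case False
      then have "E y (x 1)" using tour[OF yW x_in y1] by simp
      then have "has_path E W (x 2) (x 1) 3" unfolding has_path_def
        by (intro exI[of _ "[x 2, y, x 1]"]) (use yV yW y1 ne x_in in auto)
      then show ?thesis by simp
    qed
    then obtain j where j: "j < 2" "has_path E W (x (Suc j)) (x j) 3"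
    proof
      assume "has_path E W (x 1) (x 0) 3"
      then show ?thesis using that[of 0] by simp
    next
      assume "has_path E W (x 2) (x 1) 3"
      then show ?thesis using that[of 1] by (simp add: numeral_2_eq_2)
    qed
    have "x j \<in> tails"
    proof (rule tails_intro)
      fix l assume "3 \<le> l" "l < n"
      then show "has_path E W (x (Suc j)) (x j) l"
        using j det[of j l] d by (cases "l = 3") auto
    qed
    moreover have "x k \<in> tails" if "k \<in> reduced_tails - {n}" for k
    proof (rule tails_intro)
      fix l assume "3 \<le> l" "l < n"
      moreover have "k < n" using that by (auto simp: reduced_tails_def)
      ultimately show "has_path E W (x (Suc k)) (x k) l"
        using reduced_path[of k l] that d by simp
    qed
    moreover define i where "i = (if j = 0 then n else 1)"
    moreover have "x i = x j" using x_n i_def j(1) by (cases "j = 0") (auto simp: less_2_cases_iff)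
    ultimately have "x ` (insert i (reduced_tails - {n})) \<subseteq> tails" by auto
    then have "card (insert i (reduced_tails - {n})) \<le> card tails"
      using n3 d2 by (intro card_tails_ge) (auto simp: reduced_tails_def i_def)
    moreover have "card (insert i (reduced_tails - {n})) = card reduced_tails"
    proof -
      have "finite reduced_tails" "i \<notin> reduced_tails - {n}"
        using d2 by (auto simp: reduced_tails_def i_def)
      then show ?thesis using card.remove[of reduced_tails n] assms(1) by simp
    qed
    ultimately show ?thesis using assms by simp
  qed
qed

text \<open>The arcs in \<open>Q\<close> are lost. Their blocked sets are disjoint, so
  \<open>2 * card Q <= d - 1\<close>. If \<open>Q\<close> is nonempty, a bridge supplies
  \<open>c' - c >= max 1 (d - 3)\<close> new arcs, which is at least \<open>card Q\<close>.\<close>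

lemma three_tails_no_chord:
  assumes "n \<notin> reduced_tails" "3 \<le> card reduced_tails"
  shows "3 \<le> card tails"
proof -
  let ?P = reduced_tails
  have fin: "finite ?P" by (simp add: reduced_tails_def)
  have P: "?P \<subseteq> {d..<n}"
    using assms(1) by (auto simp: reduced_tails_def le_less)
  \<comment> \<open>For \<open>d = 2\<close> the shortened cycle has \<open>n - 1\<close> vertices,
    so no length is missing.\<close>
  define Q where "Q = (if 3 \<le> d then {k \<in> ?P. \<not> long k} else {})"
  have good: "x k \<in> tails" if k: "k \<in> ?P - Q" for k
  proof (rule tails_intro)
    fix l assume l: "3 \<le> l" "l < n"
    have kn: "k < n" "k \<in> ?P" using k P by auto
    show "has_path E W (x (Suc k)) (x k) l"
    proof (cases "l \<le> n - d + 1")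
      case True
      then show ?thesis using reduced_path kn l by simp
    next
      case False
      then have "long k" using k l by (auto simp: Q_def split: if_splits)
      then show ?thesis using False l unfolding long_def
        by (elim allE[of _ "l - (n - d + 1)"]) auto
    qed
  qed
  show ?thesis
  proof (cases "Q = {}")
    case True
    then have "x ` ?P \<subseteq> tails" using good by auto
    then have "card ?P \<le> card tails" using P d2 by (intro card_tails_ge) auto
    then show ?thesis using assms by simp
  next
    case False
    then have d3: "3 \<le> d" and QP: "Q \<subseteq> ?P" by (auto simp: Q_def split: if_splits)
    have Qn: "Q \<subseteq> {d..<n}" "\<And>k. k \<in> Q \<Longrightarrow> \<not> long k" using QP P by (auto simp: Q_def split: if_splits)
    have finQ: "finite Q" using QP fin finite_subset by blast
    obtain k where k: "k \<in> Q" using False by blast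
    then obtain c c' where br: "bridge k c c'"
      using long_or_bridge[of k] Qn d3 by fastforce
    have br': "1 \<le> c" "c < c'" "c' < d" "d \<le> c' - c + 3" using br by (auto simp: bridge_def)
    have "x j \<in> tails" if "j \<in> {c..<c'}" for j
    proof -
      have "pancyclic_pair E W (x j) (x (Suc j))"
        using bridge_pancyclic[OF _ _ br, of j] k Qn(1) that by auto
      then show ?thesis unfolding tails_def by blast
    qed
    then have "x ` ((?P - Q) \<union> {c..<c'}) \<subseteq> tails" using good by auto
    then have "card ((?P - Q) \<union> {c..<c'}) \<le> card tails"
      using P br' dn by (intro card_tails_ge) auto
    moreover have "card ((?P - Q) \<union> {c..<c'}) = card (?P - Q) + (c' - c)"
      using P br' fin by (subst card_Un_disjoint) auto
    moreover have "card (?P - Q) = card ?P - card Q"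
      using finQ QP by (rule card_Diff_subset)
    moreover have "2 * card Q \<le> d - 1"
    proof -
      let ?B = "\<lambda>k. {c \<in> {1..<d}. blocked k c}"
      have "2 * card Q = (\<Sum>k\<in>Q. 2)" by simp
      also have "\<dots> \<le> (\<Sum>k\<in>Q. card (?B k))"
        using blocked_card Qn by (intro sum_mono) auto
      also have "\<dots> = card (\<Union>k\<in>Q. ?B k)"
      proof (rule card_UN_disjoint[symmetric])
        show "\<forall>i\<in>Q. \<forall>j\<in>Q. i \<noteq> j \<longrightarrow> ?B i \<inter> ?B j = {}"
          using blocked_unique[OF _ _ _ d3] Qn(1) by blast
      qed (use finQ in auto)
      also have "\<dots> \<le> card {1..<d}" by (intro card_mono) auto
      finally show ?thesis by simp
    qed
    moreover have "1 \<le> card Q" using False finQ by (simp add: Suc_leI card_gt_0_iff)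
    ultimately show ?thesis using assms(2) br' by linarith
  qed
qed

end

section \<open>Rotation of the cycle and induction on its length\<close>

lemma (in hamiltonian_tournament) shift:
  "hamiltonian_tournament E (\<lambda>i. x (i + s)) n" "(\<lambda>i. x (i + s)) ` {..<n} = W"
  "hamiltonian_tournament.tails E (\<lambda>i. x (i + s)) n \<subseteq> tails"
proof -
  have inj': "inj_on (\<lambda>i. x (i + s)) {..<n}"
  proof (rule inj_onI)
    fix i j assume "i \<in> {..<n}" "j \<in> {..<n}" "x (i + s) = x (j + s)"
    then show "i = j" using inj_onD[OF inj_window[of s], of "i + s" "j + s"] by simp
  qed
  show W': "(\<lambda>i. x (i + s)) ` {..<n} = W"
    using card_image[OF inj'] card_W x_in by (intro card_subset_eq) auto
  show H: "hamiltonian_tournament E (\<lambda>i. x (i + s)) n"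
  proof
    fix i show "x (i + n + s) = x (i + s)" using per[of "i + s"] by (simp add: algebra_simps)
    show "E (x (i + s)) (x (Suc i + s))" using arc by simp
    show "3 \<le> n" by (rule n3)
    show "inj_on (\<lambda>i. x (i + s)) {..<n}" by (rule inj')
    show "E u v \<longleftrightarrow> \<not> E v u"
      if "u \<in> (\<lambda>i. x (i + s)) ` {..<n}" "v \<in> (\<lambda>i. x (i + s)) ` {..<n}" "u \<noteq> v" for u v
      using that unfolding W' by (rule tour)
  qed
  show "hamiltonian_tournament.tails E (\<lambda>i. x (i + s)) n \<subseteq> tails"
  proof
    fix v assume "v \<in> hamiltonian_tournament.tails E (\<lambda>i. x (i + s)) n"
    note this[unfolded hamiltonian_tournament.tails_def[OF H], unfolded mem_Collect_eq, unfolded W']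
    then obtain i where "v = x (i + s) \<and> pancyclic_pair E W (x (i + s)) (x (Suc i + s))" ..
    then show "v \<in> tails" unfolding tails_def by auto
  qed
qed

theorem three_pancyclic_arcs:
  assumes "hamiltonian_tournament E x n"
  shows "3 \<le> card (hamiltonian_tournament.tails E x n)"
  using assms
proof (induction n arbitrary: x rule: less_induct)
  case (less n)
  interpret H: hamiltonian_tournament E x n by fact
  show ?case
  proof (cases "n = 3")
    case True
    have "x i \<in> H.tails" for i
      using H.full[of i] True unfolding H.tails_def pancyclic_pair_def H.card_W by auto
    then have "H.W \<subseteq> H.tails" by blast
    then show ?thesis using card_mono[OF H.finite_tails] H.card_W True by metis
  next
    case False
    then have n4: "4 \<le> n" using H.n3 by simp
    let ?D = "\<lambda>d. 2 \<le> d \<and> d + 2 \<le> n \<and> (\<exists>i. H.e i (i + d))"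
    \<comment> \<open>The chord between \<open>x 0\<close> and \<open>x 2\<close> is forward with
      span 2 or, read as ending in \<open>x n\<close>, forward with span
      \<open>n - 2\<close>.\<close>
    have ex: "\<exists>d. ?D d"
    proof (cases "H.e 0 2")
      case True
      then have "\<exists>i. H.e i (i + 2)" by (intro exI[of _ 0]) (simp add: numeral_2_eq_2)
      then show ?thesis using n4 by (intro exI[of _ 2]) simp
    next
      case False
      then have "H.e 2 0" using H.tour_idx[of 0 2] n4 by simp
      moreover have "2 + (n - 2) = n" using n4 by simp
      moreover have "x n = x 0" using H.per[of 0] by simp
      ultimately have "\<exists>i. H.e i (i + (n - 2))" by metis
      moreover have "2 \<le> n - 2" "n - 2 + 2 \<le> n" using n4 by linarith+
      ultimately show ?thesis by blast
    qed
    define d where "d = (LEAST d. ?D d)"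
    have D: "?D d" unfolding d_def using ex by (rule LeastI_ex)
    then obtain s where s: "H.e s (s + d)" by blast
    have "H.e (i + t) i" if "2 \<le> t" "t < d" for i t
    proof -
      have "\<not> ?D t" using not_less_Least[of t ?D] that d_def by blast
      then have "\<not> H.e i (i + t)" using that D by auto
      then show ?thesis using H.tour_idx[of i "i + t"] that D by auto
    qed
    then have bw: "H.e (i + t + s) (i + s)" if "2 \<le> t" "t < d" for i t
      using that by (metis add.assoc add.commute)
    interpret S: hamiltonian_tournament E "\<lambda>i. x (i + s)" n by (rule H.shift)
    interpret M: minimal_chord E "\<lambda>i. x (i + s)" n d
    proof
      show "H.e (0 + s) (d + s)" using s by (simp add: add.commute)
      show "H.e (i + t + s) (i + s)" if "2 \<le> t" "t < d" for i t using bw that .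
    qed (use D in auto)
    have "3 \<le> card M.reduced_tails"
      by (rule M.reduced_tails_card, rule less.IH[OF _ M.reduced_tournament(1)]) (use D in auto)
    then have "3 \<le> card S.tails"
      using M.three_tails_chord M.three_tails_no_chord by blast
    also have "\<dots> \<le> card H.tails"
      using H.shift(3)[of s] H.finite_tails by (rule card_mono[rotated])
    finally show ?thesis .
  qed
qed

section \<open>Cycles in strong semicomplete digraphs\<close>

definition cyc :: "('a \<Rightarrow> 'a \<Rightarrow> bool) \<Rightarrow> 'a list \<Rightarrow> bool" where
  "cyc E zs \<longleftrightarrow> zs \<noteq> [] \<and> distinct zs \<and> successively E (zs @ [hd zs])"

text \<open>The cut form of strong connectivity, which directly supplies the arcs needed for
  enlarging a cycle.\<close>

definition strong_on :: "'a set \<Rightarrow> ('a \<Rightarrow> 'a \<Rightarrow> bool) \<Rightarrow> bool" where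
  "strong_on V E \<longleftrightarrow> (\<forall>S. S \<subseteq> V \<and> S \<noteq> {} \<and> S \<noteq> V \<longrightarrow> (\<exists>u\<in>S. \<exists>v\<in>V - S. E u v))"

text \<open>Opening the cycle at its head reduces this to insertion into a path. Keeping the head
  keeps the vertex whose pancyclicity is to be shown.\<close>

lemma cyc_insert:
  assumes "cyc E zs" "w \<notin> set zs" "u \<in> set zs" "E u w" "v \<in> set zs" "E w v"
    and cmp: "\<And>z. z \<in> set zs \<Longrightarrow> E z w \<or> E w z"
  shows "\<exists>zs'. cyc E zs' \<and> hd zs' = hd zs \<and> set zs' = insert w (set zs) \<and> length zs' = Suc (length zs)"
proof -
  let ?L = "zs @ [hd zs]"
  have zs: "zs \<noteq> []" "distinct zs" "successively E ?L" using assms(1) by (auto simp: cyc_def)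
  \<comment> \<open>The head occurs at both ends of \<open>?L\<close>: its final copy serves if
    \<open>w\<close> points to it, its first copy otherwise.\<close>
  have "insertable E w ?L \<or> insertable E w zs"
  proof (cases "E w (hd zs)")
    case True
    have "subseq ([u] @ [hd zs]) (zs @ [hd zs])"
      by (rule list_emb_append_mono) (auto simp: subseq_singleton_left assms(3))
    then show ?thesis using True assms(4) unfolding insertable_def by auto
  next
    case False
    then have "E (hd zs) w" using cmp[of "hd zs"] zs by auto
    moreover have "v \<noteq> hd zs" using False assms(6) by auto
    then have "v \<in> set (tl zs)" using assms(5) zs by (cases zs) auto
    then have "subseq [hd zs, v] zs" using zs by (cases zs) (auto simp: subseq_singleton_left)
    ultimately show ?thesis using assms(6) unfolding insertable_def by blast
  qed
  moreover have "subseq zs ?L" by (simp add: prefix_imp_subseq)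
  ultimately have "insertable E w ?L" using insertable_subseq[of E w zs ?L] by blast
  then have "\<exists>A B. ?L = A @ B \<and> A \<noteq> [] \<and> B \<noteq> [] \<and> E (last A) w \<and> E w (hd B)"
  proof (rule insertable_split)
    fix v assume "v \<in> set ?L"
    then have "v \<in> set zs" using zs(1) by auto
    then show "E v w \<or> E w v" by (rule cmp)
  qed
  then obtain A B where AB: "?L = A @ B" "A \<noteq> []" "B \<noteq> []" "E (last A) w" "E w (hd B)"
    by blast
  define B' where "B' = butlast B"
  have "last (A @ B) = hd zs" unfolding AB(1)[symmetric] by simp
  then have B: "B = B' @ [hd zs]" using AB(3) append_butlast_last_id[of B] by (simp add: B'_def)
  then have z: "zs = A @ B'" using AB(1) by simp
  have hd: "hd (A @ w # B') = hd zs" using z AB(2) by simp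
  have "successively E (A @ B)" using zs(3) AB(1) by simp
  then have "successively E (A @ w # B)"
    using AB by (simp add: successively_append_iff successively_Cons)
  then have "successively E ((A @ w # B') @ [hd (A @ w # B')])" unfolding hd using B by simp
  moreover have "distinct (A @ w # B')" using zs(2) assms(2) z by auto
  ultimately have "cyc E (A @ w # B')" unfolding cyc_def by blast
  then show ?thesis using hd z by (intro exI[of _ "A @ w # B'"]) auto
qed

text \<open>If no outside vertex can be inserted, each one either receives arcs from the whole cycle
  or sends arcs to the whole cycle. Strong connectivity gives an arc \<open>b\<close>,
  \<open>a\<close> from the first kind (the set \<open>B\<close>) to the second.\<close>

lemma split_outside:
  assumes "strong_on V E" "cyc E zs" "set zs \<subseteq> V" "set zs \<noteq> V"
    and cmp: "\<And>u v. u \<in> V \<Longrightarrow> v \<in> V \<Longrightarrow> u \<noteq> v \<Longrightarrow> E u v \<or> E v u"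
    and no: "\<And>w u v. w \<in> V - set zs \<Longrightarrow> u \<in> set zs \<Longrightarrow> v \<in> set zs \<Longrightarrow> E u w \<Longrightarrow> \<not> E w v"
  obtains a b where "a \<in> V - set zs" "b \<in> V - set zs" "a \<noteq> b" "E b a"
    "\<And>z. z \<in> set zs \<Longrightarrow> E z b" "\<And>z. z \<in> set zs \<Longrightarrow> E a z"
proof -
  define B where "B = {w \<in> V - set zs. \<forall>z\<in>set zs. \<not> E w z}"
  have "set zs \<noteq> {}" using assms(2) by (auto simp: cyc_def)
  then obtain u v where uv: "u \<in> set zs" "v \<in> V - set zs" "E u v"
    using assms(1,3,4) unfolding strong_on_def by blast
  then have "v \<in> B" using no B_def by blast
  moreover have "B \<subseteq> V" "B \<noteq> V" using \<open>set zs \<noteq> {}\<close> assms(3) unfolding B_def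
    by (blast, metis (no_types, lifting) DiffD2 all_not_in_conv mem_Collect_eq subset_iff)
  ultimately obtain b a where ba: "b \<in> B" "a \<in> V - B" "E b a"
    using assms(1) unfolding strong_on_def by blast
  have bz: "b \<in> V - set zs" "\<And>z. z \<in> set zs \<Longrightarrow> \<not> E b z" using ba by (auto simp: B_def)
  have aV: "a \<in> V - set zs" using ba bz by blast
  have "E a z" if "z \<in> set zs" for z
  proof -
    obtain y where "y \<in> set zs" "E a y" using aV ba(2) by (auto simp: B_def)
    then have "\<not> E z a" using no aV that by blast
    then show ?thesis using cmp[of a z] aV that assms(3) by blast
  qed
  moreover have "E z b" if "z \<in> set zs" for z
    using cmp[of b z] bz that assms(3) by blast
  moreover have "a \<noteq> b" using ba by blast
  ultimately show ?thesis using that aV bz(1) ba(3) by blast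
qed

lemma cyc_arcs:
  assumes "cyc E zs" "i < length zs" shows "E (zs ! i) (zs ! ((i + 1) mod length zs))"
proof -
  have *: "successively E (zs @ [hd zs])" "zs \<noteq> []" using assms by (auto simp: cyc_def)
  then have "E ((zs @ [hd zs]) ! i) ((zs @ [hd zs]) ! Suc i)"
    using assms(2) unfolding successively_conv_nth by simp
  then show ?thesis
    using assms(2) *(2) by (cases "Suc i = length zs") (auto simp: nth_append hd_conv_nth)
qed

theorem strong_semicomplete_hamiltonian:
  assumes "finite V" "V \<noteq> {}" "strong_on V E"
    and cmp: "\<And>u v. u \<in> V \<Longrightarrow> v \<in> V \<Longrightarrow> E u v \<or> E v u"
  shows "\<exists>zs. cyc E zs \<and> set zs = V"
proof -
  \<comment> \<open>Only a lower bound on the length, since inserting both \<open>b\<close> and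
    \<open>a\<close> adds two vertices. The induction starts from a loop: \<open>cmp\<close> makes
    \<open>E\<close> reflexive on \<open>V\<close>.\<close>
  have "\<exists>zs. cyc E zs \<and> set zs \<subseteq> V \<and> l \<le> length zs" if "l \<le> card V" for l
    using that
  proof (induction l)
    case 0
    obtain v where v: "v \<in> V" using assms(2) by blast
    then have "cyc E [v]" using cmp[of v v] by (simp add: cyc_def)
    then show ?case using v by (intro exI[of _ "[v]"]) simp
  next
    case (Suc l)
    then obtain zs where zs: "cyc E zs" "set zs \<subseteq> V" "l \<le> length zs" by auto
    show ?case
    proof (cases "Suc l \<le> length zs")
      case False
      then have "length zs \<noteq> card V" using zs Suc.prems by simp
      then have ne: "set zs \<noteq> V" using distinct_card[of zs] zs by (auto simp: cyc_def)
      show ?thesis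
      proof (cases "\<exists>w\<in>V - set zs. \<exists>u\<in>set zs. \<exists>v\<in>set zs. E u w \<and> E w v")
        case True
        then obtain w u v where w: "w \<in> V - set zs" "u \<in> set zs" "v \<in> set zs" "E u w" "E w v"
          by blast
        have "\<exists>zs'. cyc E zs' \<and> hd zs' = hd zs \<and> set zs' = insert w (set zs) \<and>
           length zs' = Suc (length zs)"
          by (rule cyc_insert[of E zs w u v]) (use w zs cmp in auto)
        then show ?thesis using w zs by (metis DiffD1 Suc_le_mono insert_subset)
      next
        case no: False
        obtain a b where ab: "a \<in> V - set zs" "b \<in> V - set zs" "a \<noteq> b" "E b a"
          "\<And>z. z \<in> set zs \<Longrightarrow> E z b" "\<And>z. z \<in> set zs \<Longrightarrow> E a z"
          by (rule split_outside[OF assms(3) zs(1,2) ne]) (use no cmp in blast)+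
        obtain v vs where v: "zs = v # vs" using zs(1) by (cases zs) (auto simp: cyc_def)
        have "cyc E (v # b # a # vs)"
          using zs(1) ab v unfolding cyc_def by (cases vs) auto
        moreover have "set (v # b # a # vs) \<subseteq> V" using zs(2) ab v by auto
        moreover have "Suc l \<le> length (v # b # a # vs)" using zs(3) v by simp
        ultimately show ?thesis by blast
      qed
    qed (use zs in blast)
  qed
  then obtain zs where zs: "cyc E zs" "set zs \<subseteq> V" "card V \<le> length zs" by blast
  then have "set zs = V"
    using distinct_card[of zs] assms(1) by (intro card_seteq) (auto simp: cyc_def)
  then show ?thesis using zs by blast
qed

theorem strong_tournament_vertex_pancyclic:
  assumes "finite V" "strong_on V E" "v \<in> V" "3 \<le> l" "l \<le> card V"
    and tour: "\<And>u v. u \<in> V \<Longrightarrow> v \<in> V \<Longrightarrow> u \<noteq> v \<Longrightarrow> E u v \<longleftrightarrow> \<not> E v u"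
  shows "\<exists>zs. cyc E zs \<and> set zs \<subseteq> V \<and> hd zs = v \<and> length zs = l"
  using assms(4,5)
proof (induction l rule: dec_induct)
  case base
  have V: "V \<noteq> {v}" using base by auto
  \<comment> \<open>An arc leaving the out-neighbourhood of \<open>v\<close> ends in a vertex that
    points to \<open>v\<close>, which gives a triangle.\<close>
  define S where "S = {u \<in> V - {v}. E v u}"
  have "\<exists>u\<in>{v}. \<exists>w\<in>V - {v}. E u w"
    using assms(2,3) V unfolding strong_on_def by blast
  then have "S \<noteq> {}" unfolding S_def by blast
  moreover have "S \<subseteq> V" "S \<noteq> V" using assms(3) unfolding S_def by auto
  ultimately obtain u w where uw: "u \<in> S" "w \<in> V - S" "E u w"
    using assms(2) unfolding strong_on_def by blast
  have "w \<noteq> v" using uw tour[of u v] assms(3) unfolding S_def by auto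
  then have "E w v" using uw tour[of w v] assms(3) unfolding S_def by auto
  moreover have "u \<noteq> w" using uw by blast
  ultimately have "cyc E [v, u, w]"
    using uw \<open>w \<noteq> v\<close> unfolding cyc_def S_def by auto
  then show ?case using uw assms(3) unfolding S_def by (intro exI[of _ "[v, u, w]"]) auto
next
  case (step l)
  then obtain zs where zs: "cyc E zs" "set zs \<subseteq> V" "hd zs = v" "length zs = l" by auto
  then have ne: "set zs \<noteq> V" using distinct_card[of zs] step by (auto simp: cyc_def)
  have cmp: "E u v \<or> E v u" if "u \<in> V" "v \<in> V" "u \<noteq> v" for u v using tour that by blast
  show ?case
  proof (cases "\<exists>w\<in>V - set zs. \<exists>u\<in>set zs. \<exists>v\<in>set zs. E u w \<and> E w v")
    case True
    then obtain w u v where w: "w \<in> V - set zs" "u \<in> set zs" "v \<in> set zs" "E u w" "E w v"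
      by blast
    have "E z w \<or> E w z" if "z \<in> set zs" for z using cmp[of z w] w(1) that zs(2) by blast
    then have "\<exists>zs'. cyc E zs' \<and> hd zs' = hd zs \<and> set zs' = insert w (set zs) \<and>
       length zs' = Suc (length zs)"
      using w zs(1) by (intro cyc_insert[of E zs w u v]) auto
    then obtain zs' where "cyc E zs'" "hd zs' = hd zs" "set zs' = insert w (set zs)"
      "length zs' = Suc (length zs)" by blast
    then show ?thesis using w(1) zs by (intro exI[of _ zs']) auto
  next
    case no: False
    obtain a b where ab: "a \<in> V - set zs" "b \<in> V - set zs" "a \<noteq> b" "E b a"
      "\<And>z. z \<in> set zs \<Longrightarrow> E z b" "\<And>z. z \<in> set zs \<Longrightarrow> E a z"
      by (rule split_outside[OF assms(2) zs(1,2) ne cmp]) (use no in blast)+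
    obtain y z vs where v: "zs = v # y # z # vs"
    proof -
      obtain p where "zs = v # p" using zs(1,3) by (cases zs) (auto simp: cyc_def)
      moreover from this obtain y q where "p = y # q" using zs(4) step by (cases p) auto
      moreover from calculation obtain z r where "q = z # r" using zs(4) step by (cases q) auto
      ultimately show ?thesis using that by blast
    qed
    \<comment> \<open>Here \<open>b\<close> and \<open>a\<close> replace \<open>y\<close>, so the
      length grows by exactly one and \<open>v\<close> stays.\<close>
    have "cyc E (v # b # a # z # vs)"
      using zs(1) ab v unfolding cyc_def by auto
    moreover have "set (v # b # a # z # vs) \<subseteq> V" using zs(2) ab v by auto
    moreover have "length (v # b # a # z # vs) = Suc l" using zs(4) v by simp
    ultimately show ?thesis by (metis list.sel(1))
  qed
qed

lemma (in hamiltonian_tournament) strong_W: "strong_on W E"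
  unfolding strong_on_def
proof (intro allI impI, rule ccontr)
  fix S assume S: "S \<subseteq> W \<and> S \<noteq> {} \<and> S \<noteq> W" and no: "\<not> (\<exists>u\<in>S. \<exists>v\<in>W - S. E u v)"
  then obtain i where i: "x i \<in> S" by blast
  have step: "x (i + j) \<in> S" for j
  proof (induction j)
    case (Suc j)
    then show ?case using no arc[of "i + j"] x_in[of "Suc (i + j)"] by auto
  qed (use i in simp)
  have "W \<subseteq> S"
  proof
    fix v assume "v \<in> W"
    then obtain j where j: "v = x j" by blast
    have "v = x (j + i * n)" using per_mult j by simp
    moreover have "j + i * n = i + (j + i * n - i)"
      using n3 by (simp add: trans_le_add2)
    ultimately show "v \<in> S" using step by metis
  qed
  then show False using S by blast
qed

section \<open>Systems of distinct representatives\<close>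

text \<open>Hall's marriage theorem by the classical induction: if every proper nonempty subfamily
  has a surplus, any representative of one member is safe; otherwise a tight subfamily is solved
  apart from the rest.\<close>

theorem hall:
  assumes "finite I" "\<And>i. i \<in> I \<Longrightarrow> finite (S i)"
    and "\<And>J. J \<subseteq> I \<Longrightarrow> card J \<le> card (\<Union>(S ` J))"
  shows "\<exists>f. inj_on f I \<and> (\<forall>i\<in>I. f i \<in> S i)"
  using assms
proof (induction "card I" arbitrary: I S rule: less_induct)
  case less
  have finU: "finite (\<Union>(S ` J))" if "J \<subseteq> I" for J
    using less.prems(1,2) that finite_subset[of J I] by blast
  show ?case
  proof (cases "I = {}")
    case False
    then obtain i where i: "i \<in> I" by blast
    show ?thesis
    proof (cases "\<forall>J. J \<subset> I \<longrightarrow> J \<noteq> {} \<longrightarrow> card J < card (\<Union>(S ` J))")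
      case True
      have "card {i} \<le> card (\<Union>(S ` {i}))" using less.prems(3)[of "{i}"] i by blast
      then obtain y where y: "y \<in> S i" by fastforce
      have "\<exists>f. inj_on f (I - {i}) \<and> (\<forall>j\<in>I - {i}. f j \<in> S j - {y})"
      proof (rule less.hyps)
        show "card (I - {i}) < card I" using i less.prems(1) by (rule card_Diff1_less[rotated])
        fix J assume J: "J \<subseteq> I - {i}"
        have eq: "\<Union>((\<lambda>j. S j - {y}) ` J) = \<Union>(S ` J) - {y}" by auto
        show "card J \<le> card (\<Union>((\<lambda>j. S j - {y}) ` J))"
        proof (cases "J = {}")
          case False
          moreover have "J \<subset> I" using J i by blast
          ultimately have "card J < card (\<Union>(S ` J))" using True by blast
          moreover have "card (\<Union>(S ` J)) \<le> Suc (card (\<Union>(S ` J) - {y}))"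
            using diff_card_le_card_Diff[of "{y}" "\<Union>(S ` J)"] by simp
          ultimately show ?thesis unfolding eq by simp
        qed simp
      qed (use less.prems in auto)
      then obtain f where f: "inj_on f (I - {i})" "\<forall>j\<in>I - {i}. f j \<in> S j - {y}" by blast
      have "inj_on (f(i := y)) I" using f by (auto simp: inj_on_def)
      moreover have "\<forall>j\<in>I. (f(i := y)) j \<in> S j" using f y by auto
      ultimately show ?thesis by blast
    next
      case False
      then obtain J where J: "J \<subset> I" "J \<noteq> {}" "card (\<Union>(S ` J)) \<le> card J"
        unfolding not_less[symmetric] by blast
      have finJ: "finite J" using J less.prems(1) finite_subset by blast
      have "\<exists>f. inj_on f J \<and> (\<forall>j\<in>J. f j \<in> S j)"
      proof (rule less.hyps)
        show "card J < card I" using J less.prems(1) by (intro psubset_card_mono) auto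
        show "finite (S i)" if "i \<in> J" for i using less.prems(2) that J by blast
        show "card K \<le> card (\<Union>(S ` K))" if "K \<subseteq> J" for K using less.prems(3) that J by blast
      qed (rule finJ)
      then obtain f where f: "inj_on f J" "\<forall>j\<in>J. f j \<in> S j" by blast
      let ?U = "\<Union>(S ` J)"
      have "\<exists>g. inj_on g (I - J) \<and> (\<forall>j\<in>I - J. g j \<in> S j - ?U)"
      proof (rule less.hyps)
        show "card (I - J) < card I"
          using J less.prems(1) by (intro psubset_card_mono) auto
        fix K assume K: "K \<subseteq> I - J"
        have finK: "finite K" using K less.prems(1) finite_subset by blast
        have "card K + card J = card (K \<union> J)"
          using K finK finJ by (intro card_Un_disjoint[symmetric]) auto
        also have "\<dots> \<le> card (\<Union>(S ` (K \<union> J)))"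
          using K J by (intro less.prems(3)) auto
        also have "\<Union>(S ` (K \<union> J)) = \<Union>((\<lambda>j. S j - ?U) ` K) \<union> ?U" by auto
        also have "card \<dots> \<le> card (\<Union>((\<lambda>j. S j - ?U) ` K)) + card ?U"
          by (rule card_Un_le)
        finally show "card K \<le> card (\<Union>((\<lambda>j. S j - ?U) ` K))" using J(3) by simp
      qed (use less.prems in auto)
      then obtain g where g: "inj_on g (I - J)" "\<forall>j\<in>I - J. g j \<in> S j - ?U" by blast
      let ?h = "\<lambda>j. if j \<in> J then f j else g j"
      have "inj_on ?h I"
      proof (rule inj_onI)
        fix a b assume ab: "a \<in> I" "b \<in> I" "?h a = ?h b"
        have "?h a \<in> ?U \<longleftrightarrow> a \<in> J" "?h b \<in> ?U \<longleftrightarrow> b \<in> J" using f(2) g(2) ab(1,2) by auto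
        then have "a \<in> J \<longleftrightarrow> b \<in> J" using ab(3) by simp
        then show "a = b"
          using ab inj_onD[OF f(1), of a b] inj_onD[OF g(1), of a b] by (cases "a \<in> J") auto
      qed
      moreover have "\<forall>j\<in>I. ?h j \<in> S j" using f g by auto
      ultimately show ?thesis by blast
    qed
  qed simp
qed

text \<open>Each index outside \<open>J\<close> has more candidates than conflicting indices, so one
  is still free when its turn comes.\<close>

lemma greedy_representatives:
  assumes "finite L" "J \<subseteq> L" "inj_on f J" "\<And>i. i \<in> J \<Longrightarrow> f i \<in> S i"
    and lt: "\<And>i. i \<in> L - J \<Longrightarrow> card {j \<in> L - {i}. S i \<inter> S j \<noteq> {}} < card (S i)"
  shows "\<exists>g. inj_on g L \<and> (\<forall>i\<in>L. g i \<in> S i) \<and> (\<forall>i\<in>J. g i = f i)"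
proof -
  have "\<exists>g. inj_on g (J \<union> K) \<and> (\<forall>i\<in>J \<union> K. g i \<in> S i) \<and> (\<forall>i\<in>J. g i = f i)"
    if "finite K" "K \<subseteq> L - J" for K
    using that
  proof (induction K)
    case empty
    then show ?case using assms(3,4) by auto
  next
    case (insert i K)
    then obtain g where g: "inj_on g (J \<union> K)" "\<forall>i\<in>J \<union> K. g i \<in> S i" "\<forall>i\<in>J. g i = f i" by auto
    let ?C = "{j \<in> L - {i}. S i \<inter> S j \<noteq> {}}"
    have i: "i \<in> L - J" "i \<notin> J \<union> K" using insert by auto
    have "S i \<inter> g ` (J \<union> K) \<subseteq> g ` ?C" using g(2) i insert.prems assms(2) by blast
    then have "card (S i \<inter> g ` (J \<union> K)) \<le> card (g ` ?C)"
      using assms(1) by (intro card_mono) auto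
    also have "\<dots> \<le> card ?C" using assms(1) by (intro card_image_le) auto
    also have "\<dots> < card (S i)" using lt i by blast
    finally have "S i \<inter> g ` (J \<union> K) \<noteq> S i" by auto
    then obtain y where y: "y \<in> S i" "y \<notin> g ` (J \<union> K)" by blast
    have "inj_on (g(i := y)) (J \<union> insert i K)"
      using g(1) y(2) i(2) by (auto simp: inj_on_def)
    moreover have "\<forall>j\<in>J \<union> insert i K. (g(i := y)) j \<in> S j" using g(2) y(1) by auto
    moreover have "\<forall>j\<in>J. (g(i := y)) j = f j" using g(3) i(2) by auto
    ultimately show ?case by blast
  qed
  from this[of "L - J"] show ?thesis using assms(1,2) by (simp add: Un_absorb1)
qed

section \<open>Counting hyperarcs\<close>

locale hypertournament =
  fixes V :: "'a set" and A :: "'a list set" and n k :: nat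
  assumes finV: "finite V" and cardV: "card V = n" and n7: "7 \<le> n" and k3: "3 \<le> k" and kn: "k + 3 \<le> n"
    and ktour: "k_tournament k V A"
begin

definition hyp :: "'a \<Rightarrow> 'a \<Rightarrow> 'a list set" where "hyp u v = {a \<in> A. precedes a u v}"

definition M :: nat where "M = (n - 2) choose (k - 2)"

definition heavy :: "'a \<Rightarrow> 'a \<Rightarrow> bool" where "heavy u v \<longleftrightarrow> M \<le> 2 * card (hyp u v)"

lemma hyperarc: assumes "a \<in> A" shows "distinct a" "length a = k" "set a \<subseteq> V" "card (set a) = k"
  using ktour assms distinct_card[of a] unfolding k_tournament_def by auto

lemma finA: "finite A"
proof -
  have "A \<subseteq> {xs. set xs \<subseteq> V \<and> length xs = k}" using hyperarc by blast
  then show ?thesis using finite_lists_length_eq[OF finV] finite_subset by blast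
qed

lemma fin_hyp: "finite (hyp u v)" unfolding hyp_def using finA by simp

lemma precedes_in: "precedes a u v \<Longrightarrow> u \<in> set a \<and> v \<in> set a"
  unfolding precedes_def by force

lemma precedes_asym: assumes "a \<in> A" "precedes a u v" shows "\<not> precedes a v u"
proof
  assume "precedes a v u"
  with assms(2) obtain i j i' j' where *: "i < j" "j < length a" "a ! i = u" "a ! j = v"
    "i' < j'" "j' < length a" "a ! i' = v" "a ! j' = u" unfolding precedes_def by blast
  then have "i = j'" "j = i'" using hyperarc(1)[OF assms(1)] nth_eq_iff_index_eq by fastforce+
  then show False using * by simp
qed

lemma precedes_neq: "a \<in> A \<Longrightarrow> precedes a u v \<Longrightarrow> u \<noteq> v"
  using precedes_asym by blast

lemma precedes_total:
  assumes "u \<in> set a" "v \<in> set a" "u \<noteq> v" shows "precedes a u v \<or> precedes a v u"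
proof -
  obtain i j where *: "i < length a" "a ! i = u" "j < length a" "a ! j = v"
    using assms by (meson in_set_conv_nth)
  then show ?thesis using assms(3) unfolding precedes_def
    by (cases i j rule: linorder_cases) auto
qed

lemma precedes_trans:
  assumes "a \<in> A" "precedes a u v" "precedes a v w" shows "precedes a u w"
proof -
  obtain i j j' l where *: "i < j" "j < length a" "a ! i = u" "a ! j = v"
    "j' < l" "l < length a" "a ! j' = v" "a ! l = w" using assms unfolding precedes_def by blast
  then have "j = j'" using hyperarc(1)[OF assms(1)] nth_eq_iff_index_eq by fastforce
  then show ?thesis using * unfolding precedes_def by (intro exI[of _ i] exI[of _ l]) auto
qed

lemma precedes_not_last: assumes "a \<in> A" "precedes a u v" shows "u \<noteq> last a"
proof
  assume u: "u = last a"
  obtain i j where *: "i < j" "j < length a" "a ! i = u" using assms unfolding precedes_def by blast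
  then have "a ! i = a ! (length a - 1)" using u last_conv_nth[of a] by fastforce
  then have "i = length a - 1" using * hyperarc(1)[OF assms(1)] nth_eq_iff_index_eq[of a i "length a - 1"] by simp
  then show False using * by simp
qed

lemma card_containing:
  assumes "U \<subseteq> V" "card U \<le> k"
  shows "card {a \<in> A. U \<subseteq> set a} = (n - card U) choose (k - card U)"
proof -
  let ?T = "{T. T \<subseteq> V - U \<and> card T = k - card U}"
  have finU: "finite U" using assms finV finite_subset by blast
  have "bij_betw (\<lambda>a. set a - U) {a \<in> A. U \<subseteq> set a} ?T"
  proof (rule bij_betwI')
    fix a b assume ab: "a \<in> {a \<in> A. U \<subseteq> set a}" "b \<in> {a \<in> A. U \<subseteq> set a}"
    have "a = b" if "set a - U = set b - U"
    proof -
      have "set a = set b" using that ab by blast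
      moreover have "\<exists>!c. c \<in> A \<and> set c = set a"
        using ktour ab(1) hyperarc(3,4)[of a] unfolding k_tournament_def by auto
      ultimately show ?thesis using ab by auto
    qed
    then show "(set a - U = set b - U) = (a = b)" by blast
  next
    fix a assume "a \<in> {a \<in> A. U \<subseteq> set a}"
    then show "set a - U \<in> ?T" using hyperarc[of a] finU by (auto simp: card_Diff_subset)
  next
    fix T assume T: "T \<in> ?T"
    then have "finite T" using finV finite_subset by blast
    then have "card (T \<union> U) = k" using T finU assms(2) by (subst card_Un_disjoint) auto
    moreover have "T \<union> U \<subseteq> V" using T assms by blast
    ultimately obtain a where "a \<in> A" "set a = T \<union> U"
      using ktour unfolding k_tournament_def by blast
    then show "\<exists>a\<in>{a \<in> A. U \<subseteq> set a}. T = set a - U" using T by (intro bexI[of _ a]) auto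
  qed
  then have "card {a \<in> A. U \<subseteq> set a} = card ?T" by (rule bij_betw_same_card)
  also have "\<dots> = card (V - U) choose (k - card U)" using finV by (intro n_subsets) auto
  also have "card (V - U) = n - card U" using assms cardV finU by (simp add: card_Diff_subset)
  finally show ?thesis .
qed

lemma hyp_disjoint: "hyp u v \<inter> hyp v u = {}"
  using precedes_asym[of _ u v] by (auto simp: hyp_def)

lemma card_hyp:
  assumes "u \<in> V" "v \<in> V" "u \<noteq> v" shows "card (hyp u v) + card (hyp v u) = M"
proof -
  have "hyp u v \<union> hyp v u = {a \<in> A. {u, v} \<subseteq> set a}"
    using precedes_in[of _ u v] precedes_in[of _ v u] precedes_total[of u _ v] assms(3)
    by (auto simp: hyp_def)
  then have "card (hyp u v) + card (hyp v u) = card {a \<in> A. {u, v} \<subseteq> set a}"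
    using card_Un_disjoint[OF fin_hyp fin_hyp hyp_disjoint] by metis
  also have "\<dots> = M" using card_containing[of "{u, v}"] assms k3 unfolding M_def by (simp add: numeral_2_eq_2)
  finally show ?thesis .
qed

lemma heavy_total: "u \<in> V \<Longrightarrow> v \<in> V \<Longrightarrow> u \<noteq> v \<Longrightarrow> heavy u v \<or> heavy v u"
  using card_hyp[of u v] unfolding heavy_def by linarith

lemma heavy_3: assumes "k = 3" "heavy u v" shows "3 \<le> card (hyp u v)"
  using assms n7 unfolding heavy_def M_def by simp

lemma M_7_4: "n = 7 \<Longrightarrow> k = 4 \<Longrightarrow> M = 10"
  unfolding M_def by (simp add: choose_two)

text \<open>As \<open>2 <= k - 2 <= n - 5\<close>, \<open>M\<close> is at least
  \<open>(n - 2) choose 2\<close>, which is at least \<open>2 * n - 1\<close> for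
  \<open>n >= 8\<close>, with equality 15 = 15 at \<open>n = 8\<close>.\<close>

lemma heavy_large: assumes "4 \<le> k" "8 \<le> n" "heavy u v" shows "n \<le> card (hyp u v)"
proof -
  have "(n - 2) choose 2 \<le> M"
  proof (cases "2 * (k - 2) \<le> n - 2")
    case True
    then show ?thesis unfolding M_def using assms by (intro binomial_mono) auto
  next
    case False
    have "(n - 2) choose 2 \<le> (n - 2) choose ((n - 2) - (k - 2))"
      using False kn by (intro binomial_mono) auto
    also have "\<dots> = M" unfolding M_def using kn by (intro binomial_symmetric[symmetric]) auto
    finally show ?thesis .
  qed
  moreover have "2 * n - 1 \<le> (n - 2) choose 2"
  proof -
    obtain m where m: "n = m + 8" using assms(2) le_Suc_ex by (metis add.commute)
    have "(4 * n - 2) \<le> (n - 2) * (n - 2 - 1)" unfolding m by (simp add: algebra_simps)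
    then show ?thesis unfolding choose_two by linarith
  qed
  ultimately show ?thesis using assms(3) unfolding heavy_def by linarith
qed

section \<open>Distinct hyperarcs for the arcs of a cycle\<close>

definition slot :: "'a list \<Rightarrow> nat \<Rightarrow> 'a list set" where
  "slot zs i = hyp (zs ! i) (zs ! ((i + 1) mod length zs))"

lemma slot_sub: "slot zs i \<subseteq> A" by (auto simp: slot_def hyp_def)

lemma fin_slot: "finite (slot zs i)" by (simp add: slot_def fin_hyp)

lemma slot_in:
  assumes "h \<in> slot zs i" shows "zs ! i \<in> set h" "zs ! ((i + 1) mod length zs) \<in> set h"
  using assms precedes_in[of h "zs ! i" "zs ! ((i + 1) mod length zs)"] unfolding slot_def hyp_def by auto

text \<open>The slots containing \<open>h\<close> start in different vertices of \<open>h\<close>,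
  never in its last one.\<close>

lemma slots_of_hyperarc:
  assumes "distinct zs" "h \<in> A" shows "card {i \<in> {..<length zs}. h \<in> slot zs i} \<le> k - 1"
proof -
  let ?I = "{i \<in> {..<length zs}. h \<in> slot zs i}"
  have h: "h \<noteq> []" using hyperarc(2)[OF assms(2)] k3 by auto
  have "inj_on ((!) zs) ?I" using assms(1) by (auto simp: inj_on_def nth_eq_iff_index_eq)
  moreover have "(!) zs ` ?I \<subseteq> set h - {last h}"
  proof
    fix v assume "v \<in> (!) zs ` ?I"
    then obtain i where i: "v = zs ! i" "h \<in> slot zs i" by auto
    then have "precedes h v (zs ! ((i + 1) mod length zs))" by (simp add: slot_def hyp_def)
    then have "v \<noteq> last h" by (rule precedes_not_last[OF assms(2)])
    then show "v \<in> set h - {last h}" using slot_in(1) i by blast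
  qed
  ultimately have "card ?I \<le> card (set h - {last h})" by (intro card_inj_on_le) auto
  also have "\<dots> = k - 1" using hyperarc(4)[OF assms(2)] h by simp
  finally show ?thesis .
qed

lemma succ_mod:
  fixes i j l :: nat
  assumes "3 \<le> l" "i < l" "j < l"
  shows "(i + 1) mod l \<noteq> i" "(i + 1) mod l < l" "(i + 1) mod l = (j + 1) mod l \<Longrightarrow> i = j"
    "((i + 1) mod l + 1) mod l \<noteq> i" "(j + 1) mod l = i \<Longrightarrow> j = (i + l - 1) mod l"
proof -
  have m: "(i + 1) mod l = (if i + 1 = l then 0 else i + 1)" if "i < l" for i using that by auto
  show "(i + 1) mod l \<noteq> i" "(i + 1) mod l < l" "(i + 1) mod l = (j + 1) mod l \<Longrightarrow> i = j"
    using assms m[of i] m[of j] by (auto split: if_splits)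
  show "((i + 1) mod l + 1) mod l \<noteq> i"
    using assms m[of i] by (auto split: if_splits simp: mod_Suc)
  assume "(j + 1) mod l = i"
  then show "j = (i + l - 1) mod l" using assms m[of j] by (auto split: if_splits)
qed

text \<open>Two slots that are not cyclically adjacent involve four vertices, too many for a
  hyperarc of size three.\<close>

lemma conflict_3:
  assumes "k = 3" "distinct zs" "length zs = l" "3 \<le> l" "i < l"
  shows "card {j \<in> {..<l} - {i}. slot zs i \<inter> slot zs j \<noteq> {}} \<le> 2"
proof -
  have "{j \<in> {..<l} - {i}. slot zs i \<inter> slot zs j \<noteq> {}} \<subseteq> {(i + 1) mod l, (i + l - 1) mod l}"
  proof
    fix j assume "j \<in> {j \<in> {..<l} - {i}. slot zs i \<inter> slot zs j \<noteq> {}}"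
    then obtain h where j: "j < l" "j \<noteq> i" and h: "h \<in> slot zs i" "h \<in> slot zs j" by auto
    let ?i = "(i + 1) mod l" and ?j = "(j + 1) mod l"
    show "j \<in> {(i + 1) mod l, (i + l - 1) mod l}"
    proof (rule ccontr)
      assume no: "j \<notin> {(i + 1) mod l, (i + l - 1) mod l}"
      have "distinct [i, ?i, j, ?j]"
        using no succ_mod[OF assms(4,5) j(1)] succ_mod[OF assms(4) j(1) assms(5)] j by auto
      moreover have lt: "i < l" "?i < l" "j < l" "?j < l" using assms j by auto
      ultimately have "distinct (map ((!) zs) [i, ?i, j, ?j])"
        using assms(2,3) by (auto simp: nth_eq_iff_index_eq)
      then have "card (set (map ((!) zs) [i, ?i, j, ?j])) = 4" using distinct_card by fastforce
      moreover have "set (map ((!) zs) [i, ?i, j, ?j]) \<subseteq> set h"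
        using slot_in[OF h(1)] slot_in[OF h(2)] assms(3) by auto
      ultimately have "4 \<le> card (set h)" using card_mono[of "set h"] by (metis List.finite_set)
      moreover have "h \<in> A" using h slot_sub by blast
      ultimately show False using hyperarc(4)[of h] assms(1) by simp
    qed
  qed
  then have "card {j \<in> {..<l} - {i}. slot zs i \<inter> slot zs j \<noteq> {}} \<le> card {(i + 1) mod l, (i + l - 1) mod l}"
    by (intro card_mono) auto
  also have "\<dots> \<le> 2" by (simp add: card_insert_if)
  finally show ?thesis .
qed

text \<open>Two slots involve at least three vertices, and three given vertices lie in
  \<open>(7 - 3) choose (4 - 3) = 4\<close> hyperarcs.\<close>

lemma slot_overlap:
  assumes "n = 7" "k = 4" "distinct zs" "length zs = l" "3 \<le> l" "i < l" "j < l" "i \<noteq> j" "set zs \<subseteq> V"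
  shows "card (slot zs i \<inter> slot zs j) \<le> 4"
proof -
  let ?i = "(i + 1) mod l" and ?j = "(j + 1) mod l"
  note sm = succ_mod[OF assms(5,6,7)] succ_mod[OF assms(5,7,6)]
  obtain m where m: "m \<in> {j, ?j}" "distinct [i, ?i, m]" "m < l"
  proof (cases "j = ?i")
    case True
    then have "distinct [i, ?i, ?j]" using sm by auto
    then show ?thesis using that[of ?j] sm by auto
  next
    case False
    then have "distinct [i, ?i, j]" using sm assms(8) by auto
    then show ?thesis using that[of j] assms(7) by auto
  qed
  let ?U = "set (map ((!) zs) [i, ?i, m])"
  have "distinct (map ((!) zs) [i, ?i, m])"
    using m assms sm(2) by (auto simp: nth_eq_iff_index_eq)
  then have "card ?U = 3" using distinct_card by fastforce
  moreover have "?U \<subseteq> V" using assms m(3) sm(2) nth_mem by fastforce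
  ultimately have "card {a \<in> A. ?U \<subseteq> set a} = 4"
    using card_containing[of ?U] assms by simp
  moreover have "slot zs i \<inter> slot zs j \<subseteq> {a \<in> A. ?U \<subseteq> set a}"
    using slot_in[of _ zs i] slot_in[of _ zs j] slot_sub[of zs i] m(1) assms(4) by auto
  ultimately show ?thesis
    using card_mono[of "{a \<in> A. ?U \<subseteq> set a}" "slot zs i \<inter> slot zs j"] finA by simp
qed

text \<open>Hall's condition without the at most four prescribed hyperarcs: one slot keeps at least
  \<open>5 - 4\<close>, two keep at least \<open>5 + 5 - 4 - 4\<close>, and larger sets need double
  counting.\<close>

lemma representatives_7_4:
  assumes nk: "n = 7" "k = 4" and zs: "distinct zs" "set zs \<subseteq> V" "length zs = l" "3 \<le> l"
    and J: "J \<subseteq> {..<l}" "card J \<le> 4" and f: "inj_on f J" "\<And>i. i \<in> J \<Longrightarrow> f i \<in> slot zs i"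
    and big: "\<And>i. i \<in> {..<l} - J \<Longrightarrow> 5 \<le> card (slot zs i)"
  shows "\<exists>g. inj_on g {..<l} \<and> (\<forall>i<l. g i \<in> slot zs i) \<and> (\<forall>i\<in>J. g i = f i)"
proof -
  have finJ: "finite J" using J finite_subset by blast
  have cf: "card (f ` J) \<le> 4" using card_image_le[OF finJ, of f] J(2) by simp
  have "\<exists>g. inj_on g ({..<l} - J) \<and> (\<forall>i\<in>{..<l} - J. g i \<in> slot zs i - f ` J)"
  proof (rule hall)
    fix I assume I: "I \<subseteq> {..<l} - J"
    let ?X = "\<Union>((\<lambda>i. slot zs i - f ` J) ` I)"
    have finI: "finite I" using I finite_subset by blast
    have finX: "finite ?X" using finI fin_slot by auto
    consider "I = {}" | i where "I = {i}" | i j where "I = {i, j}" "i \<noteq> j" | "3 \<le> card I"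
    proof -
      consider "card I = 0" | "card I = 1" | "card I = 2" | "3 \<le> card I" by linarith
      then show ?thesis using that finI by cases (auto simp: card_1_singleton_iff card_2_iff)
    qed
    then show "card I \<le> card ?X"
    proof cases
      case 1
      then show ?thesis by simp
    next
      case (2 i)
      then have "5 \<le> card (slot zs i)" using big I by auto
      moreover have "card (slot zs i) - card (f ` J) \<le> card (slot zs i - f ` J)"
        using finJ by (intro diff_card_le_card_Diff) auto
      ultimately show ?thesis using 2 cf by simp
    next
      case (3 i j)
      then have ij: "5 \<le> card (slot zs i)" "5 \<le> card (slot zs j)" "i < l" "j < l" using big I by auto
      have "card (slot zs i \<union> slot zs j) + card (slot zs i \<inter> slot zs j)
          = card (slot zs i) + card (slot zs j)"
        using card_Un_Int[OF fin_slot fin_slot] by simp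
      then have "6 \<le> card (slot zs i \<union> slot zs j)"
        using ij slot_overlap[OF nk zs(1,3,4) ij(3,4) 3(2) zs(2)] by linarith
      moreover have "card (slot zs i \<union> slot zs j) - card (f ` J) \<le> card (slot zs i \<union> slot zs j - f ` J)"
        using finJ by (intro diff_card_le_card_Diff) auto
      moreover have "?X = slot zs i \<union> slot zs j - f ` J" using 3 by auto
      ultimately show ?thesis using 3 cf by simp
    next
      case 4
      \<comment> \<open>A hyperarc lies in at most three slots; a prescribed one lies in at most two
        of \<open>I\<close>, as it also lies in its own slot in \<open>J\<close>. So
        \<open>5 * card I <= 3 * card ?X + 8\<close>, which suffices from \<open>card I = 3\<close>
        on.\<close>
      let ?Y = "\<Union>(slot zs ` I) \<inter> f ` J"
      let ?c = "\<lambda>h. card {i \<in> I. h \<in> slot zs i}"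
      have finY: "finite ?Y" using finJ by simp
      have c3: "?c h \<le> 3" if "h \<in> A" for h
      proof -
        have "?c h \<le> card {i \<in> {..<length zs}. h \<in> slot zs i}" using I zs(3) by (intro card_mono) auto
        then show ?thesis using slots_of_hyperarc[OF zs(1) that] nk by simp
      qed
      have c2: "?c h \<le> 2" if h: "h \<in> ?Y" for h
      proof -
        obtain j where j: "j \<in> J" "h = f j" using h by blast
        have "insert j {i \<in> I. h \<in> slot zs i} \<subseteq> {i \<in> {..<length zs}. h \<in> slot zs i}"
          using I J j f(2) zs(3) by auto
        then have "card (insert j {i \<in> I. h \<in> slot zs i}) \<le> card {i \<in> {..<length zs}. h \<in> slot zs i}"
          by (intro card_mono) auto
        moreover have "h \<in> A" using h slot_sub by blast
        moreover have "j \<notin> {i \<in> I. h \<in> slot zs i}" using I j by auto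
        ultimately show ?thesis using slots_of_hyperarc[OF zs(1), of h] nk finI by simp
      qed
      have "5 * card I = (\<Sum>i\<in>I. 5)" by simp
      also have "\<dots> \<le> (\<Sum>i\<in>I. card (slot zs i))" using big I by (intro sum_mono) auto
      also have "\<dots> = (\<Sum>i\<in>I. card {h \<in> ?X \<union> ?Y. h \<in> slot zs i})"
        by (intro sum.cong refl arg_cong[of _ _ card]) auto
      also have "\<dots> = (\<Sum>h\<in>?X \<union> ?Y. ?c h)"
        using finI finX finY by (intro sum_multicount_gen) auto
      also have "\<dots> = (\<Sum>h\<in>?X. ?c h) + (\<Sum>h\<in>?Y. ?c h)"
        using finX finY by (intro sum.union_disjoint) auto
      also have "\<dots> \<le> (\<Sum>h\<in>?X. 3) + (\<Sum>h\<in>?Y. 2)"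
        using slot_sub by (intro add_mono sum_mono c2 c3) auto
      also have "\<dots> = 3 * card ?X + 2 * card ?Y" by simp
      finally have "5 * card I \<le> 3 * card ?X + 2 * card ?Y" .
      moreover have "card ?Y \<le> card (f ` J)" using finJ by (intro card_mono) auto
      ultimately show ?thesis using cf 4 by linarith
    qed
  qed (use fin_slot in auto)
  then obtain g where g: "inj_on g ({..<l} - J)" "\<And>i. i \<in> {..<l} - J \<Longrightarrow> g i \<in> slot zs i - f ` J" by blast
  let ?h = "\<lambda>i. if i \<in> J then f i else g i"
  have "inj_on ?h {..<l}"
  proof (rule inj_onI)
    fix a b assume ab: "a \<in> {..<l}" "b \<in> {..<l}" "?h a = ?h b"
    have "?h a \<in> f ` J \<longleftrightarrow> a \<in> J" "?h b \<in> f ` J \<longleftrightarrow> b \<in> J" using g(2) ab(1,2) by auto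
    then have "a \<in> J \<longleftrightarrow> b \<in> J" using ab(3) by simp
    then show "a = b"
      using ab inj_onD[OF f(1), of a b] inj_onD[OF g(1), of a b] by (cases "a \<in> J") auto
  qed
  moreover have "\<forall>i<l. ?h i \<in> slot zs i" using f(2) g(2) by auto
  ultimately show ?thesis by (intro exI[of _ ?h]) auto
qed

lemma representatives:
  assumes zs: "distinct zs" "set zs \<subseteq> V" "length zs = l" "3 \<le> l"
    and J: "J \<subseteq> {..<l}" "n = 7 \<Longrightarrow> k = 4 \<Longrightarrow> card J \<le> 4"
    and f: "inj_on f J" "\<And>i. i \<in> J \<Longrightarrow> f i \<in> slot zs i"
    and heavy: "\<And>i. i \<in> {..<l} - J \<Longrightarrow> heavy (zs ! i) (zs ! ((i + 1) mod l))"
  shows "\<exists>g. inj_on g {..<l} \<and> (\<forall>i<l. g i \<in> slot zs i) \<and> (\<forall>i\<in>J. g i = f i)"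
proof -
  have ln: "l \<le> n" using zs(1,2,3) card_mono[OF finV] distinct_card cardV by metis
  \<comment> \<open>For \<open>n = 7\<close>, \<open>k + 3 <= n\<close> leaves only
    \<open>k = 3\<close> and \<open>k = 4\<close>.\<close>
  consider "k = 3" | "4 \<le> k" "8 \<le> n" | "n = 7" "k = 4" using k3 kn n7 by linarith
  then show ?thesis
  proof cases
    case 3
    then have "5 \<le> card (slot zs i)" if "i \<in> {..<l} - J" for i
      using heavy[OF that] M_7_4 zs(3) unfolding heavy_def slot_def by simp
    then show ?thesis using representatives_7_4[OF 3 zs J(1) J(2)[OF 3] f] by blast
  next
    case 1
    have "\<exists>g. inj_on g {..<l} \<and> (\<forall>i\<in>{..<l}. g i \<in> slot zs i) \<and> (\<forall>i\<in>J. g i = f i)"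
    proof (rule greedy_representatives[OF _ J(1) f])
      fix i assume i: "i \<in> {..<l} - J"
      show "card {j \<in> {..<l} - {i}. slot zs i \<inter> slot zs j \<noteq> {}} < card (slot zs i)"
        using conflict_3[OF 1 zs(1,3,4), of i] heavy_3[OF 1 heavy[OF i]] i zs(3)
        unfolding slot_def by simp
    qed auto
    then show ?thesis by auto
  next
    case 2
    have "\<exists>g. inj_on g {..<l} \<and> (\<forall>i\<in>{..<l}. g i \<in> slot zs i) \<and> (\<forall>i\<in>J. g i = f i)"
    proof (rule greedy_representatives[OF _ J(1) f])
      fix i assume i: "i \<in> {..<l} - J"
      have "card {j \<in> {..<l} - {i}. slot zs i \<inter> slot zs j \<noteq> {}} \<le> card ({..<l} - {i})"
        by (intro card_mono) auto
      also have "\<dots> < n" using i ln n7 by auto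
      also have "\<dots> \<le> card (slot zs i)" using heavy_large[OF 2 heavy[OF i]] zs(3) unfolding slot_def by simp
      finally show "card {j \<in> {..<l} - {i}. slot zs i \<inter> slot zs j \<noteq> {}} < card (slot zs i)" .
    qed auto
    then show ?thesis by auto
  qed
qed

lemma representatives_cycle:
  assumes zs: "distinct zs" "set zs \<subseteq> V" "length zs = l" "zs \<noteq> []"
    and g: "inj_on g {..<l}" "\<And>i. i < l \<Longrightarrow> g i \<in> slot zs i"
  shows "is_cycle V A zs (map g [0..<l])"
  unfolding is_cycle_def
  using assms slot_sub by (auto simp: distinct_map atLeast0LessThan slot_def hyp_def)

end

section \<open>Existence of a Hamiltonian cycle\<close>

text \<open>A new vertex is either reached from the old root or becomes the root itself.\<close>

lemma total_source:
  assumes "finite F" "F \<noteq> {}"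
    and tot: "\<And>u v. u \<in> F \<Longrightarrow> v \<in> F \<Longrightarrow> u \<noteq> v \<Longrightarrow> (u, v) \<in> G \<or> (v, u) \<in> G"
  shows "\<exists>r\<in>F. \<forall>v\<in>F. (r, v) \<in> G\<^sup>*"
  using assms
proof (induction F rule: finite_ne_induct)
  case (insert w F)
  then obtain r where r: "r \<in> F" "\<forall>v\<in>F. (r, v) \<in> G\<^sup>*" by auto
  have "r \<noteq> w" using r insert by auto
  then consider "(r, w) \<in> G" | "(w, r) \<in> G" using insert.prems[of r w] r by auto
  then show ?case
  proof cases
    case 1
    then show ?thesis using r by (intro bexI[of _ r]) auto
  next
    case 2
    then show ?thesis using r by (intro bexI[of _ w]) (auto intro: converse_rtrancl_into_rtrancl)
  qed
qed simp

lemma pick_other: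
  assumes "finite B" "card B < card S" shows "\<exists>h\<in>S. h \<notin> B"
proof (rule ccontr)
  assume "\<not> (\<exists>h\<in>S. h \<notin> B)"
  then have "card S \<le> card B" using assms(1) by (intro card_mono) auto
  then show False using assms(2) by simp
qed

context hypertournament
begin

lemma not_heavy_self: "\<not> heavy u u"
proof -
  have "hyp u u = {}" unfolding hyp_def using precedes_neq by auto
  moreover have "0 < M" unfolding M_def using kn by simp
  ultimately show ?thesis unfolding heavy_def by simp
qed

definition parc :: "'a list \<Rightarrow> 'a \<Rightarrow> 'a \<Rightarrow> bool" where
  "parc ys u v \<longleftrightarrow> (\<exists>j. Suc j < length ys \<and> u = ys ! j \<and> v = ys ! Suc j)"

lemma path_hyp:
  assumes "is_path V A ys bs" "j < length bs" shows "bs ! j \<in> hyp (ys ! j) (ys ! Suc j)"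
proof -
  have "bs ! j \<in> A" using assms nth_mem[of j bs] unfolding is_path_def by blast
  then show ?thesis using assms unfolding is_path_def hyp_def by auto
qed

text \<open>Arcs shared with the path keep its hyperarcs, which are distinct, and the other arcs are
  heavy. The set \<open>F\<close> bounds the number of prescribed hyperarcs through the tails of
  their arcs.\<close>

lemma cycle_through_path:
  assumes P: "is_path V A ys bs" and zs: "distinct zs" "set zs = V"
    and arcs: "\<And>i. i < n \<Longrightarrow> heavy (zs ! i) (zs ! ((i + 1) mod n)) \<or> parc ys (zs ! i) (zs ! ((i + 1) mod n))"
    and few: "n = 7 \<Longrightarrow> k = 4 \<Longrightarrow> \<exists>F. finite F \<and> card F \<le> 4 \<and>
       (\<forall>i<n. parc ys (zs ! i) (zs ! ((i + 1) mod n)) \<longrightarrow> zs ! i \<in> F)"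
  shows "\<exists>as. hamiltonian_cycle V A zs as"
proof -
  have len: "length zs = n" using zs distinct_card cardV by metis
  define J where "J = {i \<in> {..<n}. parc ys (zs ! i) (zs ! ((i + 1) mod n))}"
  have lb: "length ys = length bs + 1" "distinct bs" using P unfolding is_path_def by auto
  have "\<forall>i\<in>J. \<exists>j. j < length bs \<and> zs ! i = ys ! j \<and> zs ! ((i + 1) mod n) = ys ! Suc j"
    using lb(1) unfolding J_def parc_def by auto
  then obtain q where q: "\<And>i. i \<in> J \<Longrightarrow> q i < length bs" "\<And>i. i \<in> J \<Longrightarrow> zs ! i = ys ! q i"
    "\<And>i. i \<in> J \<Longrightarrow> zs ! ((i + 1) mod n) = ys ! Suc (q i)" by metis
  have "\<exists>g. inj_on g {..<n} \<and> (\<forall>i<n. g i \<in> slot zs i) \<and> (\<forall>i\<in>J. g i = bs ! q i)"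
  proof (rule representatives)
    show "3 \<le> n" using n7 by simp
    show "J \<subseteq> {..<n}" unfolding J_def by auto
    show "heavy (zs ! i) (zs ! ((i + 1) mod n))" if "i \<in> {..<n} - J" for i
      using arcs[of i] that unfolding J_def by auto
    show "bs ! q i \<in> slot zs i" if "i \<in> J" for i
      using path_hyp[OF P q(1)[OF that]] q(2,3)[OF that] len unfolding slot_def by simp
    have injz: "inj_on ((!) zs) J" using zs(1) len unfolding J_def by (auto simp: inj_on_def nth_eq_iff_index_eq)
    show "inj_on (\<lambda>i. bs ! q i) J"
    proof (rule inj_onI)
      fix i j assume ij: "i \<in> J" "j \<in> J" "bs ! q i = bs ! q j"
      then have "q i = q j" using q(1) lb(2) by (simp add: nth_eq_iff_index_eq)
      then have "zs ! i = zs ! j" using q(2) ij by simp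
      then show "i = j" using inj_onD[OF injz] ij by blast
    qed
    show "card J \<le> 4" if nk: "n = 7" "k = 4"
    proof -
      obtain F where F: "finite F" "card F \<le> 4"
        "\<forall>i<n. parc ys (zs ! i) (zs ! ((i + 1) mod n)) \<longrightarrow> zs ! i \<in> F" using few[OF nk] by blast
      have "card J \<le> card F" using injz F(1,3) by (intro card_inj_on_le[of "(!) zs"]) (auto simp: J_def)
      then show ?thesis using F(2) by simp
    qed
  qed (use zs len in auto)
  then obtain g where g: "inj_on g {..<n}" "\<And>i. i < n \<Longrightarrow> g i \<in> slot zs i" by blast
  have "zs \<noteq> []" using len n7 by auto
  then have "is_cycle V A zs (map g [0..<n])"
    using representatives_cycle[of zs n g] zs len g by simp
  then show ?thesis using zs(2) unfolding hamiltonian_cycle_def by blast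
qed

lemma cycle7I:
  assumes "distinct [z0, z1, z2, z3, z4, z5, z6]" "set [z0, z1, z2, z3, z4, z5, z6] = V"
    and "distinct [a0, a1, a2, a3, a4, a5, a6]"
    and "a0 \<in> hyp z0 z1" "a1 \<in> hyp z1 z2" "a2 \<in> hyp z2 z3" "a3 \<in> hyp z3 z4" "a4 \<in> hyp z4 z5"
      "a5 \<in> hyp z5 z6" "a6 \<in> hyp z6 z0"
  shows "\<exists>zs as. hamiltonian_cycle V A zs as"
proof -
  let ?z = "[z0, z1, z2, z3, z4, z5, z6]" and ?a = "[a0, a1, a2, a3, a4, a5, a6]"
  have "precedes (?a ! i) (?z ! i) (?z ! ((i + 1) mod 7))" if "i < 7" for i
  proof -
    have "i = 0 \<or> i = 1 \<or> i = 2 \<or> i = 3 \<or> i = 4 \<or> i = 5 \<or> i = 6" using that by linarith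
    then show ?thesis using assms(4-) unfolding hyp_def by (elim disjE) simp_all
  qed
  moreover have "set ?a \<subseteq> A" using assms(4-) unfolding hyp_def by simp
  ultimately have "is_cycle V A ?z ?a" using assms(1,2,3) unfolding is_cycle_def by simp
  then show ?thesis using assms(2) unfolding hamiltonian_cycle_def by blast
qed


text \<open>The path may prescribe too many hyperarcs for \<open>representatives\<close>, but it
  misses at most one vertex, and by \<open>bk\<close> all ten hyperarcs on its ends lead from the
  last vertex to the first.\<close>

lemma hamiltonian_7_4:
  assumes nk: "n = 7" "k = 4"
    and P: "is_path V A ys bs" "5 \<le> length bs" and bk: "hyp (hd ys) (last ys) = {}"
    and out: "\<And>w. w \<in> V \<Longrightarrow> w \<noteq> hd ys \<Longrightarrow> \<exists>v\<in>V. heavy w v"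
    and into: "\<And>w. w \<in> V \<Longrightarrow> w \<noteq> last ys \<Longrightarrow> \<exists>v\<in>V. heavy v w"
  shows "\<exists>zs as. hamiltonian_cycle V A zs as"
proof -
  have lb: "length ys = length bs + 1" "distinct ys" "distinct bs" "set ys \<subseteq> V" using P(1) unfolding is_path_def by auto
  have "card (set ys) \<le> 7" using card_mono[OF finV lb(4)] cardV nk by simp
  then have l7: "length ys \<le> 7" using distinct_card[OF lb(2)] by simp
  have M10: "M = 10" using M_7_4 nk by simp
  have ne: "ys \<noteq> []" using lb(1) by auto
  have hl: "hd ys \<in> V" "last ys \<in> V" using ne lb(4) by (auto dest: hd_in_set last_in_set)
  have "hd ys \<noteq> last ys"
    using lb P(2) by (cases ys) (auto simp: distinct_length_2_or_more dest: last_in_set split: if_splits)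
  then have c10: "card (hyp (last ys) (hd ys)) = 10"
    using card_hyp[OF hl] bk M10 by simp
  note ph = path_hyp[OF P(1)]
  consider "length bs = 6" | "length bs = 5" using P(2) l7 lb(1) by linarith
  then show ?thesis
  proof cases
    case 1
    then obtain y0 y1 y2 y3 y4 y5 y6 where y: "ys = [y0, y1, y2, y3, y4, y5, y6]"
      using lb(1) by (auto simp: numeral_eq_Suc length_Suc_conv)
    from 1 obtain b0 b1 b2 b3 b4 b5 where b: "bs = [b0, b1, b2, b3, b4, b5]"
      by (auto simp: numeral_eq_Suc length_Suc_conv)
    have "card (set bs) < card (hyp (last ys) (hd ys))" using c10 card_length[of bs] 1 by simp
    then obtain h where h: "h \<in> hyp (last ys) (hd ys)" "h \<notin> set bs"
      using pick_other[of "set bs"] by blast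
    have "set ys = V" using lb(2,4) distinct_card[OF lb(2)] finV cardV nk y by (intro card_subset_eq) auto
    then show ?thesis
      using lb(2,3) y b h ph[of 0] ph[of 1] ph[of 2] ph[of 3] ph[of 4] ph[of 5]
      by (intro cycle7I[of y0 y1 y2 y3 y4 y5 y6 b0 b1 b2 b3 b4 b5 h]) auto
  next
    case 2
    then obtain y0 y1 y2 y3 y4 y5 where y: "ys = [y0, y1, y2, y3, y4, y5]"
      using lb(1) by (auto simp: numeral_eq_Suc length_Suc_conv)
    from 2 obtain b0 b1 b2 b3 b4 where b: "bs = [b0, b1, b2, b3, b4]"
      by (auto simp: numeral_eq_Suc length_Suc_conv)
    have bh: "b0 \<in> hyp y0 y1" "b1 \<in> hyp y1 y2" "b2 \<in> hyp y2 y3" "b3 \<in> hyp y3 y4" "b4 \<in> hyp y4 y5"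
      using ph[of 0] ph[of 1] ph[of 2] ph[of 3] ph[of 4] y b by simp_all
    have dy: "distinct [y0, y1, y2, y3, y4, y5]" and db: "distinct [b0, b1, b2, b3, b4]"
      using lb(2,3) y b by simp_all
    have c10': "card (hyp y5 y0) = 10" using c10 y by simp
    have "card (V - set ys) = 1"
      using card_Diff_subset[of "set ys" V] lb(4) distinct_card[OF lb(2)] cardV nk y by simp
    then obtain w where w: "V - set ys = {w}" by (auto simp: card_1_singleton_iff)
    then have V: "V = insert w (set ys)" and wy: "w \<notin> set ys" and wV: "w \<in> V" using lb(4) by auto
    let ?B = "{b0, b1, b2, b3, b4}"
    have cB: "card ?B = 5" using db by simp
    \<comment> \<open>Since \<open>w\<close> has heavy neighbours in both directions, the direction
      must switch from in to out somewhere on the closed round \<open>y0\<close>, ...,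
      \<open>y5\<close>, \<open>y0\<close>.\<close>
    consider i where "i < 5" "heavy (ys ! i) w" "heavy w (ys ! Suc i)"
      | "heavy y5 w" "heavy w y0"
    proof (rule ccontr)
      assume no: "\<not> thesis"
      note elim = that
      have a: "\<not> (heavy y5 w \<and> heavy w y0)" using no elim(2) by blast
      have c: "\<not> (heavy (ys ! i) w \<and> heavy w (ys ! Suc i))" if "i < 5" for i
        using no elim(1)[OF that] by blast
      have c': "\<not> (heavy y0 w \<and> heavy w y1)" "\<not> (heavy y1 w \<and> heavy w y2)"
        "\<not> (heavy y2 w \<and> heavy w y3)" "\<not> (heavy y3 w \<and> heavy w y4)" "\<not> (heavy y4 w \<and> heavy w y5)"
        using c[of 0] c[of 1] c[of 2] c[of 3] c[of 4] y by simp_all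
      have t: "heavy v w \<or> heavy w v" if "v \<in> set ys" for v
        using heavy_total[of v w] that wy wV V by auto
      have t': "heavy y0 w \<or> heavy w y0" "heavy y1 w \<or> heavy w y1" "heavy y2 w \<or> heavy w y2"
        "heavy y3 w \<or> heavy w y3" "heavy y4 w \<or> heavy w y4" "heavy y5 w \<or> heavy w y5"
        using t y by simp_all
      have "hd ys \<in> set ys" "last ys \<in> set ys" using ne by simp_all
      then have "w \<noteq> hd ys" "w \<noteq> last ys" using wy by auto
      then obtain v v' where v: "v \<in> V" "heavy w v" "v' \<in> V" "heavy v' w" using out into wV by blast
      then have "v \<in> set ys" "v' \<in> set ys" using V not_heavy_self by auto
      then have "heavy w y0 \<or> heavy w y1 \<or> heavy w y2 \<or> heavy w y3 \<or> heavy w y4 \<or> heavy w y5"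
        "heavy y0 w \<or> heavy y1 w \<or> heavy y2 w \<or> heavy y3 w \<or> heavy y4 w \<or> heavy y5 w"
        using v y by auto
      then show False using a c' t' by argo
    qed
    then show ?thesis
    proof cases
      case (1 i)
      \<comment> \<open>The detour via \<open>w\<close> drops one path arc, so at most four
        hyperarcs are prescribed; the closing pair \<open>y5\<close>, \<open>y0\<close> is
        heavy.\<close>
      define zs where "zs = take (Suc i) ys @ w # drop (Suc i) ys"
      have ly: "length ys = 6" using y by simp
      have nz: "zs ! j = (if j \<le> i then ys ! j else if j = Suc i then w else ys ! (j - 1))"
        if "j < 7" for j
      proof -
        have "\<not> j \<le> i \<Longrightarrow> j \<noteq> Suc i \<Longrightarrow> Suc (j - 2) = j - Suc 0" by linarith
        then show ?thesis
          using that 1(1) ly unfolding zs_def by (auto simp: nth_append nth_Cons' min_def)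
      qed
      have dz: "distinct zs"
        using lb(2) wy unfolding zs_def
        by (auto dest: in_set_takeD in_set_dropD simp: set_take_disj_set_drop_if_distinct)
      have "set zs = insert w (set (take (Suc i) ys @ drop (Suc i) ys))"
        unfolding zs_def set_append by auto
      then have sz: "set zs = V" unfolding append_take_drop_id V .
      have h50: "heavy (ys ! 5) (ys ! 0)" using c10' y M10 unfolding heavy_def by simp
      have nw: "\<not> parc ys u w" for u using wy unfolding parc_def by auto
      have arcs: "heavy (zs ! j) (zs ! ((j + 1) mod n)) \<or> parc ys (zs ! j) (zs ! ((j + 1) mod n))"
        if j: "j < n" for j
      proof -
        consider "j < i" | "j = i" | "j = Suc i" | "Suc i < j" "j < 6" | "j = 6" using j nk by linarith
        then show ?thesis
        proof cases
          case 4
          then have "zs ! j = ys ! (j - 1)" "zs ! ((j + 1) mod n) = ys ! Suc (j - 1)"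
            using nz[of j] nz[of "Suc j"] nk by simp_all
          then show ?thesis using 4 ly unfolding parc_def by (intro disjI2 exI[of _ "j - 1"]) simp
        next
          case c: 1
          then have "zs ! j = ys ! j" "zs ! ((j + 1) mod n) = ys ! Suc j"
            using nz[of j] nz[of "Suc j"] nk 1(1) by simp_all
          then show ?thesis using c 1(1) ly unfolding parc_def by (intro disjI2 exI[of _ j]) simp
        next
          case c: 2
          then have "zs ! j = ys ! i" "zs ! ((j + 1) mod n) = w"
            using nz[of j] nz[of "Suc j"] nk 1(1) by simp_all
          then show ?thesis using 1(2) by simp
        next
          case c: 3
          then have "zs ! j = w" "zs ! ((j + 1) mod n) = ys ! Suc i"
            using nz[of j] nz[of "Suc j"] nk 1(1) by simp_all
          then show ?thesis using 1(3) by simp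
        next
          case c: 5
          then have "zs ! j = ys ! 5" "zs ! ((j + 1) mod n) = ys ! 0"
            using nz[of j] nz[of 0] nk 1(1) by simp_all
          then show ?thesis using h50 by simp
        qed
      qed
      have "\<exists>F. finite F \<and> card F \<le> 4 \<and>
          (\<forall>j<n. parc ys (zs ! j) (zs ! ((j + 1) mod n)) \<longrightarrow> zs ! j \<in> F)"
      proof (intro exI conjI allI impI)
        let ?F = "(!) ys ` ({..<5} - {i})"
        show "finite ?F" by simp
        have "card ?F \<le> card ({..<5} - {i})" by (rule card_image_le) simp
        then show "card ?F \<le> 4" using 1(1) by simp
        fix j assume j: "j < n" "parc ys (zs ! j) (zs ! ((j + 1) mod n))"
        then obtain m where m: "Suc m < 6" "zs ! j = ys ! m" unfolding parc_def using ly by auto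
        have "m \<noteq> i"
        proof
          assume "m = i"
          then have "zs ! j = zs ! i" using m nz[of i] 1(1) by simp
          then have "j = i" using dz j(1) nk 1(1) ly unfolding zs_def
            by (subst (asm) nth_eq_iff_index_eq) auto
          then have "zs ! ((j + 1) mod n) = w" using nz[of "Suc i"] 1(1) nk by simp
          then show False using j(2) nw by simp
        qed
        then show "zs ! j \<in> ?F" using m by auto
      qed
      then show ?thesis using cycle_through_path[OF P(1) dz sz arcs] by blast
    next
      case c: 2
      have c5: "5 \<le> card (hyp y5 w)" "5 \<le> card (hyp w y0)"
        using \<open>heavy y5 w\<close> \<open>heavy w y0\<close> M10 unfolding heavy_def by simp_all
      have mem: "y0 \<in> V" "y5 \<in> V" "w \<noteq> y0" "w \<noteq> y5" using V wy y by auto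
      have getg: "\<exists>g\<in>hyp y5 y0. g \<notin> insert h ?B" for h
        by (rule pick_other) (use c10' card_insert_le_m1[of 6 ?B h] cB in \<open>auto simp: card_insert_if\<close>)
      have V7: "set [y0, y1, y2, y3, y4, y5, w] = V" using V y by auto
      consider "hyp y5 w \<subseteq> ?B" | "hyp w y0 \<subseteq> ?B"
        | h1 h2 where "h1 \<in> hyp y5 w" "h1 \<notin> ?B" "h2 \<in> hyp w y0" "h2 \<notin> ?B" by blast
      then show ?thesis
      proof cases
        case 1
        then have eq: "hyp y5 w = ?B" using c5 cB by (intro card_seteq) simp_all
        then have "b4 \<in> hyp y4 w" using bh(5) precedes_trans[of b4 y4 y5 w] unfolding hyp_def by blast
        moreover have "hyp w y5 \<noteq> {}" using card_hyp[OF mem(2) wV mem(4)[symmetric]] eq cB M10 by auto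
        then obtain h where h: "h \<in> hyp w y5" "h \<notin> ?B" using hyp_disjoint[of w y5] eq by blast
        moreover obtain g where g: "g \<in> hyp y5 y0" "g \<notin> insert h ?B" using getg by blast
        ultimately show ?thesis
          using bh db dy wy y V7
          by (intro cycle7I[of y0 y1 y2 y3 y4 w y5 b0 b1 b2 b3 b4 h g]) auto
      next
        case 2
        \<comment> \<open>Symmetrically, \<open>w\<close> goes between \<open>y0\<close> and
          \<open>y1\<close>, with \<open>b0\<close> leading from \<open>w\<close> to
          \<open>y1\<close>.\<close>
        then have eq: "hyp w y0 = ?B" using c5 cB by (intro card_seteq) simp_all
        then have "b0 \<in> hyp w y1" using bh(1) precedes_trans[of b0 w y0 y1] unfolding hyp_def by blast
        moreover have "hyp y0 w \<noteq> {}" using card_hyp[OF mem(1) wV mem(3)[symmetric]] eq cB M10 by auto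
        then obtain h where h: "h \<in> hyp y0 w" "h \<notin> ?B" using hyp_disjoint[of w y0] eq by blast
        moreover obtain g where g: "g \<in> hyp y5 y0" "g \<notin> insert h ?B" using getg by blast
        ultimately show ?thesis
          using bh db dy wy y V7
          by (intro cycle7I[of y0 w y1 y2 y3 y4 y5 h b0 b1 b2 b3 b4 g]) auto
      next
        case (3 h1 h2)
        have "\<exists>h h'. h \<in> hyp y5 w - ?B \<and> h' \<in> hyp w y0 - ?B \<and> h \<noteq> h'"
        proof (rule ccontr)
          assume no: "\<not> ?thesis"
          then have eq: "hyp y5 w - ?B \<subseteq> {h1}" "hyp w y0 - ?B \<subseteq> {h1}" using 3 by blast+
          let ?D1 = "hyp y5 w \<inter> ?B" and ?D2 = "hyp w y0 \<inter> ?B"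
          have "card (hyp y5 w) \<le> card (insert h1 ?D1)" "card (hyp w y0) \<le> card (insert h1 ?D2)"
            using eq by (intro card_mono; blast)+
          then have "4 \<le> card ?D1" "4 \<le> card ?D2"
            using c5 by (simp_all add: card_insert_if split: if_splits)
          moreover have "card ?D1 + card ?D2 = card (?D1 \<union> ?D2) + card (?D1 \<inter> ?D2)"
            by (intro card_Un_Int) simp_all
          moreover have "card (?D1 \<union> ?D2) \<le> card ?B" by (intro card_mono) auto
          moreover have "?D1 \<inter> ?D2 \<subseteq> {b0, b4}"
          proof
            fix h assume h: "h \<in> ?D1 \<inter> ?D2"
            have big: False if u: "h \<in> hyp u v" "distinct [y0, y5, w, u, v]" for u v
            proof -
              have "set [y0, y5, w, u, v] \<subseteq> set h"
                using h u(1) precedes_in[of h] unfolding hyp_def by auto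
              then have "card (set [y0, y5, w, u, v]) \<le> card (set h)" by (intro card_mono) auto
              moreover have "h \<in> A" using h unfolding hyp_def by blast
              ultimately show False using hyperarc(4)[of h] nk distinct_card[OF u(2)] by simp
            qed
            have "distinct [y0, y5, w, y1, y2]" "distinct [y0, y5, w, y2, y3]" "distinct [y0, y5, w, y3, y4]"
              using dy wy y by auto
            then have "h \<noteq> b1" "h \<noteq> b2" "h \<noteq> b3" using big bh(2-4) by blast+
            then show "h \<in> {b0, b4}" using h by auto
          qed
          then have "card (?D1 \<inter> ?D2) \<le> card {b0, b4}" by (intro card_mono) auto
          moreover have "card {b0, b4} \<le> 2" by (simp add: card_insert_if)
          ultimately show False using cB by linarith
        qed
        then obtain h h' where "h \<in> hyp y5 w - ?B" "h' \<in> hyp w y0 - ?B" "h \<noteq> h'" by blast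
        then show ?thesis
          using bh db dy wy y V7
          by (intro cycle7I[of y0 y1 y2 y3 y4 y5 w b0 b1 b2 b3 b4 h h']) auto
      qed
    qed
  qed
qed

theorem strong_hamiltonian:
  assumes "strong V A" shows "\<exists>zs as. hamiltonian_cycle V A zs as"
proof -
  define G where "G = {(u, v). u \<in> V \<and> v \<in> V \<and> heavy u v}"
  have Vne: "V \<noteq> {}" using cardV n7 by auto
  have tot: "(u, v) \<in> G \<or> (v, u) \<in> G" if "u \<in> V" "v \<in> V" "u \<noteq> v" for u v
    using heavy_total that unfolding G_def by blast
  obtain r where r: "r \<in> V" "\<And>v. v \<in> V \<Longrightarrow> (r, v) \<in> G\<^sup>*"
    using total_source[OF finV Vne, of G] tot by blast
  have "\<exists>s\<in>V. \<forall>v\<in>V. (s, v) \<in> (G\<inverse>)\<^sup>*"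
    by (rule total_source[OF finV Vne]) (use tot in blast)
  then obtain s where s: "s \<in> V" "\<And>v. v \<in> V \<Longrightarrow> (v, s) \<in> G\<^sup>*"
    unfolding rtrancl_converse by blast
  let ?P = "\<lambda>p. is_path V A (fst p) (snd p) \<and> hd (fst p) = s \<and> last (fst p) = r"
  have "\<exists>p. ?P p"
  proof (cases "s = r")
    case True
    then have "?P ([s], [])" using s(1) unfolding is_path_def by simp
    then show ?thesis by blast
  next
    case False
    then obtain xs as where "is_path V A xs as \<and> hd xs = s \<and> last xs = r"
      using assms s(1) r(1) unfolding strong_def by blast
    then have "?P (xs, as)" by simp
    then show ?thesis by blast
  qed
  then obtain p where p: "?P p" "\<And>q. ?P q \<Longrightarrow> length (fst p) \<le> length (fst q)"
    using ex_has_least_nat[of ?P _ "\<lambda>p. length (fst p)"] by blast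
  define ys where "ys = fst p"
  define bs where "bs = snd p"
  have P: "is_path V A ys bs" "hd ys = s" "last ys = r" using p(1) by (simp_all add: ys_def bs_def)
  have lb: "length ys = length bs + 1" "set ys \<subseteq> V" using P(1) unfolding is_path_def by auto
  have ne: "ys \<noteq> []" using lb(1) by auto
  show ?thesis
  proof (cases "n = 7 \<and> k = 4 \<and> 5 \<le> length bs")
    case True
    have bk: "hyp (hd ys) (last ys) = {}"
    proof (rule ccontr)
      assume "hyp (hd ys) (last ys) \<noteq> {}"
      then obtain a where a: "a \<in> A" "precedes a s r" using P unfolding hyp_def by blast
      then have "?P ([s, r], [a])"
        using s(1) r(1) precedes_neq[of a s r] unfolding is_path_def by simp
      then show False using p(2)[of "([s, r], [a])"] lb(1) True unfolding ys_def by simp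
    qed
    have "\<exists>v\<in>V. heavy w v" if "w \<in> V" "w \<noteq> hd ys" for w
      using s(2)[OF that(1)] that(2) P(2) unfolding G_def
      by (auto elim: converse_rtranclE)
    moreover have "\<exists>v\<in>V. heavy v w" if "w \<in> V" "w \<noteq> last ys" for w
      using r(2)[OF that(1)] that(2) P(3) unfolding G_def
      by (auto elim: rtranclE)
    ultimately show ?thesis using hamiltonian_7_4[OF _ _ P(1) _ bk] True by blast
  next
    case few: False
    \<comment> \<open>The loops serve the comparability assumption of
      \<open>strong_semicomplete_hamiltonian\<close>; a cycle on \<open>n\<close> distinct vertices
      contains none.\<close>
    define E where "E = (\<lambda>u v. u = v \<or> heavy u v \<or> parc ys u v)"
    have "strong_on V E"
      unfolding strong_on_def
    proof (intro allI impI, rule ccontr)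
      fix S assume S: "S \<subseteq> V \<and> S \<noteq> {} \<and> S \<noteq> V" and no: "\<not> (\<exists>u\<in>S. \<exists>v\<in>V - S. E u v)"
      \<comment> \<open>A closed \<open>S\<close> contains \<open>s\<close> by heavy arcs, then
        \<open>r\<close> along the path, then all of \<open>V\<close> by heavy arcs again.\<close>
      have cl: "v \<in> S" if "(u, v) \<in> G\<^sup>*" "u \<in> S" for u v
        using that
      proof (induction rule: rtrancl_induct)
        case (step v w)
        then show ?case using no unfolding G_def E_def by blast
      qed
      obtain u where "u \<in> S" using S by blast
      then have "s \<in> S" using cl s(2) S by blast
      have path: "j < length ys \<Longrightarrow> ys ! j \<in> S" for j
      proof (induction j)
        case 0
        then show ?case using \<open>s \<in> S\<close> P(2) ne by (simp add: hd_conv_nth)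
      next
        case (Suc j)
        then have "E (ys ! j) (ys ! Suc j)" unfolding E_def parc_def by auto
        moreover have "ys ! Suc j \<in> V" using Suc.prems lb(2) nth_mem by blast
        ultimately show ?case using no Suc by auto
      qed
      have "r \<in> S" using path[of "length ys - 1"] ne P(3) by (simp add: last_conv_nth)
      then have "V \<subseteq> S" using cl r(2) by blast
      then show False using S by blast
    qed
    moreover have "E u v \<or> E v u" if "u \<in> V" "v \<in> V" for u v
      using heavy_total that unfolding E_def by blast
    ultimately obtain zs where zs: "cyc E zs" "set zs = V"
      using strong_semicomplete_hamiltonian[OF finV Vne] by blast
    have dz: "distinct zs" using zs(1) by (simp add: cyc_def)
    then have lz: "length zs = n" using zs(2) cardV distinct_card by metis
    have arcs: "heavy (zs ! i) (zs ! ((i + 1) mod n)) \<or> parc ys (zs ! i) (zs ! ((i + 1) mod n))"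
      if "i < n" for i
    proof -
      have "(i + 1) mod n \<noteq> i" "(i + 1) mod n < n" using succ_mod[of n i i] that n7 by auto
      then have "zs ! i \<noteq> zs ! ((i + 1) mod n)" using dz lz that by (simp add: nth_eq_iff_index_eq)
      then show ?thesis using cyc_arcs[OF zs(1), of i] that lz unfolding E_def by auto
    qed
    have "\<exists>as. hamiltonian_cycle V A zs as"
    proof (rule cycle_through_path[OF P(1) dz zs(2) arcs])
      assume nk: "n = 7" "k = 4"
      let ?F = "(!) ys ` {..<length bs}"
      have "finite ?F" by simp
      moreover have "card ?F \<le> 4" using few nk card_image_le[of "{..<length bs}" "(!) ys"] by simp
      moreover have "\<forall>i<n. parc ys (zs ! i) (zs ! ((i + 1) mod n)) \<longrightarrow> zs ! i \<in> ?F"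
        using lb(1) unfolding parc_def by auto
      ultimately show "\<exists>F. finite F \<and> card F \<le> 4 \<and>
         (\<forall>i<n. parc ys (zs ! i) (zs ! ((i + 1) mod n)) \<longrightarrow> zs ! i \<in> F)" by blast
    qed
    then show ?thesis by blast
  qed
qed

end

section \<open>The tournament of a Hamiltonian cycle\<close>

locale hamiltonian_hypertournament = hypertournament +
  fixes xs :: "'a list" and as :: "'a list list"
  assumes ham: "hamiltonian_cycle V A xs as"
begin

lemma C: "distinct xs" "distinct as" "length xs = n" "length as = n" "set xs = V" "set as \<subseteq> A"
  "\<And>i. i < n \<Longrightarrow> precedes (as ! i) (xs ! i) (xs ! ((i + 1) mod n))" "is_cycle V A xs as"
proof -
  show c: "is_cycle V A xs as" and V: "set xs = V" using ham unfolding hamiltonian_cycle_def by auto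
  show d: "distinct xs" using c unfolding is_cycle_def by auto
  then show l: "length xs = n" using cardV V distinct_card by metis
  show "distinct as" "length as = n" "set as \<subseteq> A"
    "\<And>i. i < n \<Longrightarrow> precedes (as ! i) (xs ! i) (xs ! ((i + 1) mod n))"
    using c l unfolding is_cycle_def by auto
qed

definition x :: "nat \<Rightarrow> 'a" where "x i = xs ! (i mod n)"

definition carc :: "'a \<Rightarrow> 'a \<Rightarrow> bool" where
  "carc u v \<longleftrightarrow> (\<exists>i. u = x i \<and> v = x (Suc i))"

definition pos :: "'a \<Rightarrow> nat" where "pos v = (THE i. i < n \<and> xs ! i = v)"

text \<open>The extra condition for \<open>n = 7\<close>, \<open>k = 4\<close> settles 5:5 ties: all five hyperarcs of a chord might
  otherwise already be in use on a cycle consisting of five arcs of \<open>xs\<close> and this chord.\<close>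

definition good :: "'a \<Rightarrow> 'a \<Rightarrow> bool" where
  "good u v \<longleftrightarrow> heavy u v \<and> (n = 7 \<and> k = 4 \<longrightarrow> 6 \<le> card (hyp u v) \<or> \<not> hyp u v \<subseteq> set as)"

text \<open>Arcs of the cycle take precedence even where they are not good, as they bring their own
  hyperarcs. Comparing positions is an arbitrary tie-break.\<close>

definition T :: "'a \<Rightarrow> 'a \<Rightarrow> bool" where
  "T u v \<longleftrightarrow> carc u v \<or> \<not> carc v u \<and> good u v \<and> (good v u \<longrightarrow> pos u < pos v)"

lemma x_eq: "x a = x b \<longleftrightarrow> a mod n = b mod n"
  using C(1,3) n7 unfolding x_def by (simp add: nth_eq_iff_index_eq)

lemma x_V: "x a \<in> V" using C(3,5) n7 nth_mem[of "a mod n" xs] unfolding x_def by simp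

lemma x_image: "x ` {..<n} = V"
proof -
  have "x ` {..<n} = (!) xs ` {..<n}" unfolding x_def by (intro image_cong) auto
  then show ?thesis using C(3,5) by (metis lessThan_atLeast0 list.set_map map_nth set_upt)
qed

lemma pos_x: "pos (x a) = a mod n"
  unfolding pos_def
proof (rule the_equality)
  show "a mod n < n \<and> xs ! (a mod n) = x a" using n7 by (simp add: x_def)
  fix i assume i: "i < n \<and> xs ! i = x a"
  then have "x i = x a" by (simp add: x_def)
  then show "i = a mod n" using i by (simp add: x_eq)
qed

lemma pos: assumes "v \<in> V" shows "pos v < n" "x (pos v) = v"
proof -
  obtain a where "v = x a" using assms x_image by blast
  then show "pos v < n" "x (pos v) = v" using pos_x[of a] n7 by (auto simp: x_eq)
qed

lemma carc_asym: "carc u v \<Longrightarrow> \<not> carc v u"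
proof
  assume "carc u v" "carc v u"
  then obtain i j where *: "u = x i" "v = x (Suc i)" "v = x j" "u = x (Suc j)"
    unfolding carc_def by blast
  then have 1: "i mod n = Suc j mod n" "Suc i mod n = j mod n" using x_eq by metis+
  then have "i mod n = Suc (Suc i) mod n" by (metis mod_Suc_eq)
  then have "n dvd Suc (Suc i) - i" using mod_eq_dvd_iff_nat[of i "Suc (Suc i)" n] by simp
  then have "n dvd 2" by (simp add: numeral_2_eq_2)
  then show False using n7 by (auto dest: dvd_imp_le)
qed

text \<open>In a 5:5 tie, the ten hyperarcs cannot all be among the seven in \<open>as\<close>, so
  one direction has a hyperarc outside.\<close>

lemma good_total:
  assumes "u \<in> V" "v \<in> V" "u \<noteq> v" shows "good u v \<or> good v u"
proof (cases "n = 7 \<and> k = 4")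
  case True
  then have s: "card (hyp u v) + card (hyp v u) = 10" using card_hyp[OF assms] M_7_4 by simp
  have no: "hyp u v \<subseteq> set as \<Longrightarrow> \<not> hyp v u \<subseteq> set as"
  proof
    assume "hyp u v \<subseteq> set as" "hyp v u \<subseteq> set as"
    then have "card (hyp u v \<union> hyp v u) \<le> card (set as)" by (intro card_mono) auto
    also have "\<dots> \<le> 7" using card_length[of as] C(4) True by simp
    finally show False using card_Un_disjoint[OF fin_hyp fin_hyp hyp_disjoint, of u v] s by simp
  qed
 have M10: "M = 10" using True M_7_4 by simp
  consider "6 \<le> card (hyp u v)" | "6 \<le> card (hyp v u)"
    | "card (hyp u v) = 5" "card (hyp v u) = 5" using s by linarith
  then show ?thesis
  proof cases
    case 3
    then show ?thesis using no unfolding good_def heavy_def M10 by auto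
  qed (simp_all add: good_def heavy_def M10)
next
  case False
  then show ?thesis using heavy_total[OF assms] unfolding good_def by auto
qed

lemma T_tour:
  assumes "u \<in> V" "v \<in> V" "u \<noteq> v" shows "T u v \<longleftrightarrow> \<not> T v u"
proof -
  have "pos u \<noteq> pos v" using pos assms by metis
  then show ?thesis
    using good_total[OF assms] carc_asym[of u v] carc_asym[of v u] unfolding T_def by auto
qed

lemma tournament: "hamiltonian_tournament T x n"
proof
  show "3 \<le> n" using n7 by simp
  show "inj_on x {..<n}" by (auto simp: inj_on_def x_eq)
  show "x (i + n) = x i" for i by (simp add: x_eq)
  show "T (x i) (x (Suc i))" for i unfolding T_def carc_def by blast
  show "T u v \<longleftrightarrow> \<not> T v u" if "u \<in> x ` {..<n}" "v \<in> x ` {..<n}" "u \<noteq> v" for u v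
    using that T_tour unfolding x_image by blast
qed

text \<open>The hyperarcs of \<open>as\<close> are prescribed on the arcs of \<open>xs\<close>, and
  the remaining arcs are heavy. The second conjunct is what puts a chosen hyperarc of
  \<open>as\<close> on the cycle.\<close>

lemma realise_cycle:
  assumes "cyc T zs" "set zs \<subseteq> V" "length zs = l" "3 \<le> l" "l < n"
  shows "\<exists>g. is_cycle V A zs (map g [0..<l]) \<and>
     (\<forall>i<l. carc (zs ! i) (zs ! ((i + 1) mod l)) \<longrightarrow> g i = as ! pos (zs ! i))"
proof -
  let ?s = "\<lambda>i. zs ! ((i + 1) mod l)"
  define J where "J = {i \<in> {..<l}. carc (zs ! i) (?s i)}"
  define f where "f = (\<lambda>i. as ! pos (zs ! i))"
  have zs: "distinct zs" "zs \<noteq> []" using assms(1) by (auto simp: cyc_def)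
  have T: "T (zs ! i) (?s i)" if "i < l" for i using cyc_arcs[OF assms(1)] that assms(3) by simp
  have zV: "zs ! i \<in> V" if "i < l" for i using that assms nth_mem by blast
  have J: "J \<subseteq> {..<l}" unfolding J_def by auto
  have finJ: "finite J" using J finite_subset by blast
  have f: "f i \<in> slot zs i" if "i \<in> J" for i
  proof -
    obtain a where a: "zs ! i = x a" "?s i = x (Suc a)" using \<open>i \<in> J\<close> unfolding J_def carc_def by blast
    have lt: "a mod n < n" using n7 by simp
    then have "precedes (as ! (a mod n)) (x a) (x (Suc a))"
      using C(7)[OF lt] unfolding x_def by (simp add: mod_Suc_eq)
    moreover have "f i = as ! (a mod n)" unfolding f_def a(1) pos_x ..
    moreover have "as ! (a mod n) \<in> A" using lt C(4,6) nth_mem by (metis subsetD)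
    ultimately show ?thesis using a assms(3) unfolding slot_def hyp_def by simp
  qed
  have fin: "inj_on f J"
  proof (rule inj_onI)
    fix i j assume ij: "i \<in> J" "j \<in> J" "f i = f j"
    then have l: "i < l" "j < l" using J by auto
    then have "pos (zs ! i) = pos (zs ! j)"
      using ij(3) C(2,4) pos(1) zV unfolding f_def by (simp add: nth_eq_iff_index_eq)
    then have "zs ! i = zs ! j" using pos(2) zV l by metis
    then show "i = j" using zs(1) l assms(3) by (simp add: nth_eq_iff_index_eq)
  qed
  have g: "good (zs ! i) (?s i)" if "i \<in> {..<l} - J" for i
    using T[of i] that unfolding T_def J_def by auto
  have "\<exists>g. inj_on g {..<l} \<and> (\<forall>i<l. g i \<in> slot zs i) \<and> (\<forall>i\<in>J. g i = f i)"
  proof (cases "n = 7 \<and> k = 4 \<and> 5 \<le> card J")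
    case False
    then show ?thesis
      using g unfolding good_def
      by (intro representatives[OF zs(1) assms(2,3,4) J _ fin f]) auto
  next
    case True
    show ?thesis
    proof (cases "J = {..<l}")
      case True
      then show ?thesis using fin f by (intro exI[of _ f]) auto
    next
      case False
      then obtain i0 where i0: "i0 \<in> {..<l} - J" using J by blast
      have "card (insert i0 J) \<le> card {..<l}" using i0 J by (intro card_mono) auto
      then have cJ: "card J = 5" "l = 6" using i0 finJ True assms(5) by auto
      then have "insert i0 J = {..<l}"
        using i0 J finJ by (intro card_subset_eq) auto
      \<comment> \<open>By \<open>good\<close>, the only chord has six hyperarcs against five
        prescribed ones, or a hyperarc outside \<open>as\<close>.\<close>
      have "\<exists>h. h \<in> slot zs i0 \<and> h \<notin> f ` J"
      proof (rule ccontr)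
        assume "\<nexists>h. h \<in> slot zs i0 \<and> h \<notin> f ` J"
        then have sub: "slot zs i0 \<subseteq> f ` J" by blast
        then have "card (slot zs i0) \<le> card (f ` J)" using finJ by (intro card_mono) auto
        also have "\<dots> \<le> 5" using card_image_le[OF finJ] cJ by metis
        finally have "card (slot zs i0) \<le> 5" .
        moreover have "f ` J \<subseteq> set as"
          using pos(1) zV J C(4) unfolding f_def by (auto intro!: nth_mem)
        ultimately show False
          using g[OF i0] sub True assms(3) unfolding good_def slot_def by auto
      qed
      then obtain h where h: "h \<in> slot zs i0" "h \<notin> f ` J" by blast
      have "inj_on (f(i0 := h)) (insert i0 J)" using fin h(2) i0 by (auto simp: inj_on_def)
      then have "inj_on (f(i0 := h)) {..<l}" using \<open>insert i0 J = {..<l}\<close> by simp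
      moreover have "(f(i0 := h)) i \<in> slot zs i" if "i < l" for i
        using f h(1) that \<open>insert i0 J = {..<l}\<close> by (cases "i = i0") auto
      moreover have "\<forall>i\<in>J. (f(i0 := h)) i = f i" using i0 by auto
      ultimately show ?thesis by blast
    qed
  qed
  then obtain g where g: "inj_on g {..<l}" "\<And>i. i < l \<Longrightarrow> g i \<in> slot zs i" "\<And>i. i \<in> J \<Longrightarrow> g i = f i"
    by blast
  have "is_cycle V A zs (map g [0..<l])"
    by (rule representatives_cycle[OF zs(1) assms(2,3) zs(2) g(1,2)])
  moreover have "\<forall>i<l. carc (zs ! i) (?s i) \<longrightarrow> g i = as ! pos (zs ! i)"
    using g(3) unfolding J_def f_def by auto
  ultimately show ?thesis by blast
qed

lemma vertex_pancyclic: "vertex_pancyclic V A"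
  unfolding vertex_pancyclic_def pancyclic_vertex_def cardV
proof (intro ballI)
  interpret H: hamiltonian_tournament T x n by (rule tournament)
  fix v l assume v: "v \<in> V" and l: "l \<in> {3..n}"
  show "\<exists>xs as. is_cycle V A xs as \<and> length xs = l \<and> v \<in> set xs"
  proof (cases "l = n")
    case True
    then show ?thesis using C v by blast
  next
    case False
    have "\<exists>zs. cyc T zs \<and> set zs \<subseteq> V \<and> hd zs = v \<and> length zs = l"
    proof (rule strong_tournament_vertex_pancyclic[OF finV _ v])
      show "strong_on V T" using H.strong_W unfolding x_image .
      show "3 \<le> l" "l \<le> card V" using l cardV by auto
    qed (rule T_tour)
    then obtain zs where zs: "cyc T zs" "set zs \<subseteq> V" "hd zs = v" "length zs = l" by blast
    then obtain g where "is_cycle V A zs (map g [0..<l])"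
      using realise_cycle[OF zs(1,2,4)] l False by auto
    moreover have "v \<in> set zs" using zs(1,3) by (auto simp: cyc_def)
    ultimately show ?thesis using zs(4) by blast
  qed
qed

lemma three_pancyclic_hyperarcs: "3 \<le> card {a \<in> set as. pancyclic_arc V A a}"
proof -
  interpret H: hamiltonian_tournament T x n by (rule tournament)
  let ?h = "\<lambda>v. as ! pos v"
  have pan: "?h v \<in> {a \<in> set as. pancyclic_arc V A a}" if v: "v \<in> H.tails" for v
  proof -
    obtain i where i: "v = x i" "pancyclic_pair T V (x i) (x (Suc i))"
      using v unfolding H.tails_def x_image by blast
    have "pos v < n" using pos(1) x_V i(1) by simp
    then have "?h v \<in> set as" using C(4) by simp
    moreover have "pancyclic_arc V A (?h v)"
      unfolding pancyclic_arc_def cardV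
    proof
      fix l assume l: "l \<in> {3..n}"
      show "\<exists>xs as'. is_cycle V A xs as' \<and> length xs = l \<and> ?h v \<in> set as'"
      proof (cases "l = n")
        case True
        then show ?thesis using C \<open>?h v \<in> set as\<close> by blast
      next
        case False
        have "has_path T V (x (Suc i)) (x i) l"
          using i(2) l unfolding pancyclic_pair_def cardV by blast
        then obtain zs where zs: "zs \<noteq> []" "hd zs = x (Suc i)" "last zs = x i" "distinct zs"
          "set zs \<subseteq> V" "length zs = l" "successively T zs" unfolding has_path_def by blast
        have "T (x i) (x (Suc i))" by (rule H.arc)
        then have "cyc T zs" using zs unfolding cyc_def by (simp add: successively_append_iff)
        moreover have "3 \<le> l" "l < n" using l False by auto
        ultimately obtain g where g: "is_cycle V A zs (map g [0..<l])"
          "\<And>j. j < l \<Longrightarrow> carc (zs ! j) (zs ! ((j + 1) mod l)) \<Longrightarrow> g j = as ! pos (zs ! j)"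
          using realise_cycle[of zs l] zs(5,6) by blast
        \<comment> \<open>The path leads from the head of the arc to its tail, so the arc is the
          closing one, at position \<open>l - 1\<close>.\<close>
        have z: "zs ! (l - 1) = x i" "zs ! ((l - 1 + 1) mod l) = x (Suc i)"
          using zs(1,2,3,6) l by (auto simp: last_conv_nth hd_conv_nth)
        then have "g (l - 1) = ?h v" using g(2)[of "l - 1"] l i(1) unfolding carc_def by force
        moreover have "g (l - 1) \<in> set (map g [0..<l])" using l by auto
        ultimately show ?thesis using g(1) zs(6) by metis
      qed
    qed
    ultimately show ?thesis by simp
  qed
  have tV: "H.tails \<subseteq> V" using H.tails_sub x_image by simp
  have "inj_on ?h H.tails"
  proof (rule inj_onI)
    fix u v assume uv: "u \<in> H.tails" "v \<in> H.tails" "?h u = ?h v"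
    then have V: "u \<in> V" "v \<in> V" using tV by auto
    then have "pos u = pos v" using uv(3) C(2,4) pos(1) by (simp add: nth_eq_iff_index_eq)
    then show "u = v" using pos(2) V by metis
  qed
  then have "card H.tails \<le> card {a \<in> set as. pancyclic_arc V A a}"
    using pan by (intro card_inj_on_le) auto
  moreover have "3 \<le> card H.tails" by (rule three_pancyclic_arcs[OF tournament])
  ultimately show ?thesis by simp
qed

end

theorem theorem6:
  fixes V :: "'a set" and A :: "'a list set" and n k :: nat
  assumes "finite V" and "card V = n" and "n \<ge> 7"
    and "3 \<le> k" and "k \<le> n - 3"
    and "k_tournament k V A" and "strong V A"
  shows "vertex_pancyclic V A \<and>
         (\<forall>xs as. hamiltonian_cycle V A xs as \<longrightarrow>
            3 \<le> card {a \<in> set as. pancyclic_arc V A a})"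
proof -
  interpret hypertournament V A n k
    by unfold_locales (use assms in auto)
  have ham: "hamiltonian_hypertournament V A n k xs as" if "hamiltonian_cycle V A xs as" for xs as
    by unfold_locales (rule that)
  obtain xs as where "hamiltonian_cycle V A xs as"
    using strong_hamiltonian[OF assms(7)] by blast
  then have "vertex_pancyclic V A"
    by (rule hamiltonian_hypertournament.vertex_pancyclic[OF ham])
  moreover have "3 \<le> card {a \<in> set as. pancyclic_arc V A a}" if "hamiltonian_cycle V A xs as" for xs as
    using that by (rule hamiltonian_hypertournament.three_pancyclic_hyperarcs[OF ham])
  ultimately show ?thesis by blast
qed

end
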